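(* Assume $\lim_{|x|\to0}\frac{|Q(x)|}{|x|}=0$; that $d=d(x)$ is a nonlinear function of the state; and that a set $\mathcal Q\subseteq\mathbb R^n$ and a scalar $\delta>0$ are known such that $|d(x)|\le\delta$ for all $x\in\mathcal Q$. Consider an experiment on the system such that $x(k)\in\mathcal Q$ for $k=0,\dots,T-1$. For a given $\Omega\succ0$ ($\Omega\in\mathbb S^{n\times n}$), suppose that the following semi-definite program is feasible with $\Delta:=\delta\sqrt T\,I_s$: minimize $\|X_1G_2\|$ over $P_1\in\mathbb S^{n\times n}$, $Y_1\in\mathbb R^{T\times n}$, $G_2\in\mathbb R^{T\times(S-n)}$, $\epsilon>0$ subject to $$Z_0Y_1=\begin{bmatrix}P_1\\ 0_{(S-n)\times n}\end{bmatrix},\qquad Z_0G_2=\begin{bmatrix}0_{n\times(S-n)}\\ I_{S-n}\end{bmatrix},$$ $$\begin{bmatrix}P_1-\Omega&(X_1Y_1)^\top&Y_1^\top\\ X_1Y_1&P_1-\epsilon E\Delta\Delta^\top E^\top&0_{n\times T}\\ Y_1&0_{T\times n}&\epsilon I_T\end{bmatrix}\succ0 .$$ For a feasible point apply $u=KZ(x)$ with $K=U_0\begin{bmatrix}G_1&G_2\end{bmatrix}$, $G_1:=Y_1P_1^{-1}$, and let $V(x):=x^\top P_1^{-1}x$. Suppose moreover that $|d(x)|\le\delta(x)$ for all $x$, where $\delta(\cdot):\mathbb R^n\to\mathbb R_+$ is some known function such that $\lim_{|x|\to0}\frac{\delta(x)}{|x|}=0$. With $\ell(x)$ and $g(x,\delta(x))$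 as defined in the context, let $\mathcal W:=\{x:\ell(x)+g(x,\delta(x))<0\}$. Then the origin is an asymptotically stable equilibrium for the closed-loop system $x^+=AZ(x)+BKZ(x)+Ed(x)$, and any set $\mathcal R_\gamma:=\{x:V(x)\le\gamma\}$ contained in $\mathcal W\cup\{0\}$ is a positively invariant set and defines an estimate of the region of attraction relative to $\overline x=0$.
   Context: Let $n,m,s,S,T$ be positive integers with $S\ge n$ (blocks of zero size are absent when $S=n$). Consider the discrete-time system $x^+=AZ(x)+Bu+Ed$, with $x\in\mathbb R^n$, $u\in\mathbb R^m$, constant matrices $A\in\mathbb R^{n\times S}$, $B\in\mathbb R^{n\times m}$ (unknown), $E\in\mathbb R^{n\times s}$ (known), $Z(x)=\begin{bmatrix}x\\ Q(x)\end{bmatrix}$ with known $Q:\mathbb R^n\to\mathbb R^{S-n}$ containing only nonlinear functions, and $d=d(x)\in\mathbb R^s$ an unknown function of the state (neglected nonlinearity). Data: samples satisfying $x(k+1)=AZ(x(k))+Bu(k)+Ed(x(k))$ for $k=0,\dots,T-1$. Define $U_0=[u(0)\ \cdots\ u(T-1)]$, $X_1=[x(1)\ \cdots\ x(T)]$, $Z_0=[Z(x(0))\ \cdots\ Z(x(T-1))]$. With $\underline\Phi:=P_1^{-1}\Omega P_1^{-1}$, define $\ell(x):=-x^\top\underline\Phi x+\ell_1(x)+\ell_2(x)+\ell_3(x)+\ell_4(x)$, where $\ell_1(x):=(2X_1G_1x+X_1G_2Q(x))^\top P_1^{-1}X_1G_2Q(x)$, $\ell_2(x):=\|\Delta\|_2\,|(2X_1G_1x+X_1G_2Q(x))^\top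 P_1^{-1}E|\,|G_2Q(x)|$, $\ell_3(x):=\|\Delta\|_2\,|2G_1x+G_2Q(x)|\,|E^\top P_1^{-1}X_1G_2Q(x)|$, $\ell_4(x):=\|\Delta\|_2^2\,\|E^\top P_1^{-1}E\|_2\,|2G_1x+G_2Q(x)|\,|G_2Q(x)|$; and $g(x,\delta(x)):=r_1(x)\delta(x)+r_2(x)\delta(x)+r_3\delta(x)^2$, where $r_1(x):=2|(X_1G_1x+X_1G_2Q(x))^\top P_1^{-1}E|$, $r_2(x):=2\|\Delta\|_2\|E^\top P_1^{-1}E\|_2\,|G_1x+G_2Q(x)|$, $r_3:=\|E^\top P_1^{-1}E\|_2$ (here $\Delta=\delta\sqrt T I_s$ with the constant $\delta$). A set $\mathcal S$ is positively invariant for $x^+=f(x)$ if for every $x(0)\in\mathcal S$ the solution satisfies $x(t)\in\mathcal S$ for $t>0$. For an asymptotically stable equilibrium $\overline x$ of $x^+=f(x)$, a set $\mathcal R$ defines a region of attraction relative to $\overline x$ if for every $x(0)\in\mathcal R$ we have $\lim_{t\to\infty}x(t)=\overline x$. $\mathbb S^{n\times n}$: real symmetric matrices; $\succ$: positive definite order; $|\cdot|$: Euclidean norm; $\|\cdot\|_2$: induced 2-norm; $\|\cdot\|$: any norm.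
   Formalization: The formal theorem additionally assumes Q(0)=0 and d(0)=0; the limits as |x|→0 do not constrain values at the origin, and without continuity there (e.g. E=1, S=n, d(0)=1) the origin need not be an equilibrium. *)

theory Defs
  imports Complex_Main "Jordan_Normal_Form.Gauss_Jordan_Elimination"
begin

text \<open>
  Vectors and matrices are those of \<^theory>\<open>Jordan_Normal_Form.Matrix\<close>, whose dimensions are
  natural numbers and may be zero. Blocks with \<open>S - n\<close> rows or columns therefore simply become
  empty when \<open>S = n\<close>.
\<close>


subsection \<open>Norms, limits and positive definiteness\<close>

definition enorm :: "real vec \<Rightarrow> real" where
  "enorm x = sqrt (x \<bullet> x)"

definition opnorm2 :: "real mat \<Rightarrow> real" where
  "opnorm2 M = (SUP x \<in> {x \<in> carrier_vec (dim_col M). enorm x \<le> 1}. enorm (M *\<^sub>v x))"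

text \<open>The filter of the limit \<open>|x| \<rightarrow> 0\<close>, punctured as usual: the point \<open>x = 0\<close> is not considered.\<close>

definition norm_to_0 :: "nat \<Rightarrow> real vec filter" where
  "norm_to_0 n = inf (filtercomap enorm (at 0)) (principal (carrier_vec n))"

definition pos_def :: "nat \<Rightarrow> real mat \<Rightarrow> bool" where
  "pos_def n M \<longleftrightarrow> M \<in> carrier_mat n n \<and> transpose_mat M = M \<and>
     (\<forall>x \<in> carrier_vec n. x \<noteq> 0\<^sub>v n \<longrightarrow> x \<bullet> (M *\<^sub>v x) > 0)"

text \<open>Only meaningful for invertible matrices.\<close>

definition minv :: "real mat \<Rightarrow> real mat" where
  "minv M = the (mat_inverse M)"

definition append_cols :: "real mat \<Rightarrow> real mat \<Rightarrow> real mat" (infixr \<open>@\<^sub>c\<close> 65) where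
  "M @\<^sub>c N = four_block_mat M N (0\<^sub>m 0 (dim_col M)) (0\<^sub>m 0 (dim_col N))"

definition linear_scalar :: "nat \<Rightarrow> (real vec \<Rightarrow> real) \<Rightarrow> bool" where
  "linear_scalar n f \<longleftrightarrow>
     (\<forall>x \<in> carrier_vec n. \<forall>y \<in> carrier_vec n. f (x + y) = f x + f y) \<and>
     (\<forall>c. \<forall>x \<in> carrier_vec n. f (c \<cdot>\<^sub>v x) = c * f x)"


subsection \<open>Discrete-time systems\<close>

text \<open>The solution of \<open>x\<^sup>+ = f(x)\<close> from \<open>x0\<close> at time \<open>t\<close> is \<open>(f ^^ t) x0\<close>.\<close>

definition tends_to_vec :: "(nat \<Rightarrow> real vec) \<Rightarrow> real vec \<Rightarrow> bool" where
  "tends_to_vec x xbar \<longleftrightarrow> (\<lambda>t. enorm (x t - xbar)) \<longlonglongrightarrow> 0"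

definition asymptotically_stable_equilibrium ::
    "nat \<Rightarrow> (real vec \<Rightarrow> real vec) \<Rightarrow> real vec \<Rightarrow> bool" where
  "asymptotically_stable_equilibrium n f xbar \<longleftrightarrow>
     xbar \<in> carrier_vec n \<and> f xbar = xbar \<and>
     (\<forall>e > 0. \<exists>r > 0. \<forall>x0 \<in> carrier_vec n. enorm (x0 - xbar) < r \<longrightarrow>
        (\<forall>t. enorm ((f ^^ t) x0 - xbar) < e)) \<and>
     (\<exists>r > 0. \<forall>x0 \<in> carrier_vec n. enorm (x0 - xbar) < r \<longrightarrow>
        tends_to_vec (\<lambda>t. (f ^^ t) x0) xbar)"

definition positively_invariant :: "(real vec \<Rightarrow> real vec) \<Rightarrow> real vec set \<Rightarrow> bool" where
  "positively_invariant f R \<longleftrightarrow> (\<forall>x0 \<in> R. \<forall>t > 0. (f ^^ t) x0 \<in> R)"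

definition region_of_attraction ::
    "nat \<Rightarrow> (real vec \<Rightarrow> real vec) \<Rightarrow> real vec \<Rightarrow> real vec set \<Rightarrow> bool" where
  "region_of_attraction n f xbar R \<longleftrightarrow>
     asymptotically_stable_equilibrium n f xbar \<and> R \<subseteq> carrier_vec n \<and>
     (\<forall>x0 \<in> R. tends_to_vec (\<lambda>t. (f ^^ t) x0) xbar)"


subsection \<open>System, data and semi-definite program\<close>

definition lift_state :: "(real vec \<Rightarrow> real vec) \<Rightarrow> real vec \<Rightarrow> real vec" where
  "lift_state Q x = x @\<^sub>v Q x"

text \<open>The matrix whose columns are \<open>w 0, \<dots>, w (T - 1)\<close>.\<close>

definition data_mat :: "nat \<Rightarrow> nat \<Rightarrow> (nat \<Rightarrow> real vec) \<Rightarrow> real mat" where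
  "data_mat r T w = mat_of_cols r (map w [0..<T])"

text \<open>
  The constraints of the program. Its objective, a norm of \<open>X1 * G2\<close>, only selects among the
  feasible points and has no influence on feasibility.
\<close>

definition sdp_feasible ::
    "nat \<Rightarrow> nat \<Rightarrow> nat \<Rightarrow> real mat \<Rightarrow> real mat \<Rightarrow> real mat \<Rightarrow> real mat \<Rightarrow> real mat \<Rightarrow>
     real mat \<Rightarrow> real mat \<Rightarrow> real mat \<Rightarrow> real \<Rightarrow> bool" where
  "sdp_feasible n S T Z0 X1 E \<Delta> \<Omega> P1 Y1 G2 \<epsilon> \<longleftrightarrow>
     P1 \<in> carrier_mat n n \<and> transpose_mat P1 = P1 \<and>
     Y1 \<in> carrier_mat T n \<and> G2 \<in> carrier_mat T (S - n) \<and> \<epsilon> > 0 \<and>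
     Z0 * Y1 = P1 @\<^sub>r 0\<^sub>m (S - n) n \<and>
     Z0 * G2 = 0\<^sub>m n (S - n) @\<^sub>r 1\<^sub>m (S - n) \<and>
     pos_def (n + n + T)
       (four_block_mat
         (four_block_mat
           (P1 - \<Omega>)  (transpose_mat (X1 * Y1))
           (X1 * Y1)  (P1 - \<epsilon> \<cdot>\<^sub>m (E * \<Delta> * transpose_mat \<Delta> * transpose_mat E)))
         (transpose_mat Y1 @\<^sub>r 0\<^sub>m n T)
         (Y1 @\<^sub>c 0\<^sub>m T n)
         (\<epsilon> \<cdot>\<^sub>m 1\<^sub>m T))"


subsection \<open>Lyapunov function and the bound on its increments\<close>

definition lyap :: "real mat \<Rightarrow> real vec \<Rightarrow> real" where
  "lyap P1 x = x \<bullet> (minv P1 *\<^sub>v x)"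

text \<open>
  The norm of a row vector \<open>w\<^sup>\<top> M\<close> is written as the norm of the column vector
  \<open>transpose_mat M *\<^sub>v w\<close>.
\<close>

definition ell1 :: "real mat \<Rightarrow> real mat \<Rightarrow> real mat \<Rightarrow> real mat \<Rightarrow> (real vec \<Rightarrow> real vec) \<Rightarrow>
    real vec \<Rightarrow> real" where
  "ell1 X1 P1 G1 G2 Q x =
     (2 \<cdot>\<^sub>v (X1 * G1 *\<^sub>v x) + X1 * G2 *\<^sub>v Q x) \<bullet> (minv P1 * X1 * G2 *\<^sub>v Q x)"

definition ell2 :: "real mat \<Rightarrow> real mat \<Rightarrow> real mat \<Rightarrow> real mat \<Rightarrow> real mat \<Rightarrow> real mat \<Rightarrow>
    (real vec \<Rightarrow> real vec) \<Rightarrow> real vec \<Rightarrow> real" where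
  "ell2 X1 E \<Delta> P1 G1 G2 Q x =
     opnorm2 \<Delta> *
     enorm (transpose_mat (minv P1 * E) *\<^sub>v (2 \<cdot>\<^sub>v (X1 * G1 *\<^sub>v x) + X1 * G2 *\<^sub>v Q x)) *
     enorm (G2 *\<^sub>v Q x)"

definition ell3 :: "real mat \<Rightarrow> real mat \<Rightarrow> real mat \<Rightarrow> real mat \<Rightarrow> real mat \<Rightarrow> real mat \<Rightarrow>
    (real vec \<Rightarrow> real vec) \<Rightarrow> real vec \<Rightarrow> real" where
  "ell3 X1 E \<Delta> P1 G1 G2 Q x =
     opnorm2 \<Delta> * enorm (2 \<cdot>\<^sub>v (G1 *\<^sub>v x) + G2 *\<^sub>v Q x) *
     enorm (transpose_mat E * minv P1 * X1 * G2 *\<^sub>v Q x)"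

definition ell4 :: "real mat \<Rightarrow> real mat \<Rightarrow> real mat \<Rightarrow> real mat \<Rightarrow> real mat \<Rightarrow>
    (real vec \<Rightarrow> real vec) \<Rightarrow> real vec \<Rightarrow> real" where
  "ell4 E \<Delta> P1 G1 G2 Q x =
     (opnorm2 \<Delta>)\<^sup>2 * opnorm2 (transpose_mat E * minv P1 * E) *
     enorm (2 \<cdot>\<^sub>v (G1 *\<^sub>v x) + G2 *\<^sub>v Q x) * enorm (G2 *\<^sub>v Q x)"

definition ell :: "real mat \<Rightarrow> real mat \<Rightarrow> real mat \<Rightarrow> real mat \<Rightarrow> real mat \<Rightarrow> real mat \<Rightarrow>
    real mat \<Rightarrow> (real vec \<Rightarrow> real vec) \<Rightarrow> real vec \<Rightarrow> real" where
  "ell X1 E \<Delta> \<Omega> P1 G1 G2 Q x =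
     - (x \<bullet> (minv P1 * \<Omega> * minv P1 *\<^sub>v x)) +
     ell1 X1 P1 G1 G2 Q x + ell2 X1 E \<Delta> P1 G1 G2 Q x +
     ell3 X1 E \<Delta> P1 G1 G2 Q x + ell4 E \<Delta> P1 G1 G2 Q x"

definition r1 :: "real mat \<Rightarrow> real mat \<Rightarrow> real mat \<Rightarrow> real mat \<Rightarrow> real mat \<Rightarrow>
    (real vec \<Rightarrow> real vec) \<Rightarrow> real vec \<Rightarrow> real" where
  "r1 X1 E P1 G1 G2 Q x =
     2 * enorm (transpose_mat (minv P1 * E) *\<^sub>v (X1 * G1 *\<^sub>v x + X1 * G2 *\<^sub>v Q x))"

definition r2 :: "real mat \<Rightarrow> real mat \<Rightarrow> real mat \<Rightarrow> real mat \<Rightarrow> real mat \<Rightarrow>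
    (real vec \<Rightarrow> real vec) \<Rightarrow> real vec \<Rightarrow> real" where
  "r2 E \<Delta> P1 G1 G2 Q x =
     2 * opnorm2 \<Delta> * opnorm2 (transpose_mat E * minv P1 * E) * enorm (G1 *\<^sub>v x + G2 *\<^sub>v Q x)"

definition r3 :: "real mat \<Rightarrow> real mat \<Rightarrow> real" where
  "r3 E P1 = opnorm2 (transpose_mat E * minv P1 * E)"

text \<open>The last argument is the value of the state-dependent bound on \<open>d\<close> at \<open>x\<close>.\<close>

definition gfun :: "real mat \<Rightarrow> real mat \<Rightarrow> real mat \<Rightarrow> real mat \<Rightarrow> real mat \<Rightarrow> real mat \<Rightarrow>
    (real vec \<Rightarrow> real vec) \<Rightarrow> real vec \<Rightarrow> real \<Rightarrow> real" where
  "gfun X1 E \<Delta> P1 G1 G2 Q x b =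
     r1 X1 E P1 G1 G2 Q x * b + r2 E \<Delta> P1 G1 G2 Q x * b + r3 E P1 * b\<^sup>2"

end

theory Submission
  imports Defs "Jordan_Normal_Form.Determinant"
begin

text \<open>
  Since \<open>Z0 [G1 G2] = I\<close>, the data turn the closed loop into
  \<open>x\<^sup>+ = (X1 - E D0)(G1 x + G2 Q(x)) + E d(x)\<close>, where the unknown matrix \<open>D0\<close> of the samples of
  \<open>d\<close> satisfies \<open>|D0\<^sup>T v| \<le> \<delta> \<surd>T |v|\<close>. By Petersen's lemma the matrix inequality makes \<open>V\<close>
  decrease along the linear part \<open>(X1 - E D0) G1\<close> for every such \<open>D0\<close>, and the remaining terms of
  \<open>V(x\<^sup>+)\<close> are estimated by Cauchy-Schwarz. As the matrix inequality is strict, this gives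
  \<open>V(x\<^sup>+) - V(x) \<le> \<ell>(x) + g(x, \<delta>(x)) - c |x|\<^sup>2\<close> with some \<open>c > 0\<close>. The margin \<open>c\<close> is essential:
  neither \<open>Q\<close> nor \<open>d\<close> nor \<open>\<delta>\<close> is assumed continuous, so \<open>\<ell> + g < 0\<close> alone would not force
  \<open>V\<close> to tend to zero, whereas with the margin \<open>V\<close> decays geometrically on the sublevel set. Near the
  origin \<open>\<ell> + g\<close> is bounded above by \<open>o(|x|\<^sup>2)\<close>.
\<close>

section \<open>Euclidean norm and operator norm\<close>

lemma zero_mult_mat_vec: "v \<in> carrier_vec nc \<Longrightarrow> 0\<^sub>m nr nc *\<^sub>v v = (0\<^sub>v nr :: real vec)"
  by (intro eq_vecI) auto

lemma mult_mat_zero_vec: "M \<in> carrier_mat nr nc \<Longrightarrow> M *\<^sub>v 0\<^sub>v nc = (0\<^sub>v nr :: real vec)"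
  by (intro eq_vecI) auto

lemma scalar_prod_self_nonneg: "0 \<le> (x :: real vec) \<bullet> x"
  unfolding scalar_prod_def by (rule sum_nonneg) simp

lemma enorm_nonneg [simp]: "0 \<le> enorm x"
  by (simp add: enorm_def scalar_prod_self_nonneg)

lemma enorm_power2: "(enorm x)\<^sup>2 = x \<bullet> x"
  by (simp add: enorm_def scalar_prod_self_nonneg)

lemma enorm_zero [simp]: "enorm (0\<^sub>v n) = 0"
  by (simp add: enorm_def scalar_prod_def)

lemma enorm_eq_0_iff: "x \<in> carrier_vec n \<Longrightarrow> enorm x = 0 \<longleftrightarrow> x = 0\<^sub>v n"
  by (auto simp: enorm_def scalar_prod_def sum_nonneg_eq_0_iff intro!: eq_vecI)

lemma enorm_pos: "x \<in> carrier_vec n \<Longrightarrow> x \<noteq> 0\<^sub>v n \<Longrightarrow> enorm x > 0"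
  using enorm_eq_0_iff[of x n] enorm_nonneg[of x] by linarith

lemma enorm_smult: "enorm (c \<cdot>\<^sub>v x) = \<bar>c\<bar> * enorm x"
proof -
  have "(c \<cdot>\<^sub>v x) \<bullet> (c \<cdot>\<^sub>v x) = c\<^sup>2 * (x \<bullet> x)"
    by (simp add: power2_eq_square)
  then show ?thesis by (simp add: enorm_def real_sqrt_mult)
qed

text \<open>Evaluating the polynomial at its minimiser \<open>t = - b / c\<close> gives the bound;
  for \<open>c = 0\<close> an affine function bounded below must have slope zero.\<close>

lemma quadratic_nonneg_discriminant:
  fixes a b c :: real
  assumes "\<And>t. 0 \<le> a + 2 * b * t + c * t\<^sup>2" and c: "0 \<le> c"
  shows "b\<^sup>2 \<le> a * c"
proof (cases "c = 0")
  case True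
  have "b = 0"
  proof (rule ccontr)
    assume "b \<noteq> 0"
    \<comment> \<open>At this \<open>t\<close> the affine function \<open>a + 2 * b * t\<close>
      equals \<open>- 1\<close>.\<close>
    then show False using assms(1)[of "- (a + 1) / (2 * b)"] True by simp
  qed
  then show ?thesis using True by simp
next
  case False
  then have "0 < c" using c by simp
  moreover have "0 \<le> a - b\<^sup>2 / c" using assms(1)[of "- b / c"] False
    by (simp add: power2_eq_square field_simps)
  ultimately show ?thesis by (simp add: field_simps)
qed

lemma sym_mat_scalar_prod:
  fixes M :: "real mat"
  assumes "M \<in> carrier_mat n n" "transpose_mat M = M" "u \<in> carrier_vec n" "v \<in> carrier_vec n"
  shows "u \<bullet> (M *\<^sub>v v) = v \<bullet> (M *\<^sub>v u)"
  using transpose_vec_mult_scalar[of M n n u v] assms comm_scalar_prod[of u n "M *\<^sub>v v"]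
  by (metis comm_scalar_prod mult_mat_vec_carrier)

text \<open>The form is nonnegative along the line \<open>u + t v\<close>, so its discriminant in
  \<open>t\<close> is nonpositive. With the identity matrix this becomes the Euclidean inequality;
  with a positive definite \<open>M\<close> it yields coercivity.\<close>

lemma psd_cauchy_schwarz:
  fixes M :: "real mat"
  assumes M: "M \<in> carrier_mat n n" "transpose_mat M = M"
    and psd: "\<And>x. x \<in> carrier_vec n \<Longrightarrow> 0 \<le> x \<bullet> (M *\<^sub>v x)"
    and u: "u \<in> carrier_vec n" and v: "v \<in> carrier_vec n"
  shows "(u \<bullet> (M *\<^sub>v v))\<^sup>2 \<le> (u \<bullet> (M *\<^sub>v u)) * (v \<bullet> (M *\<^sub>v v))"
proof (rule quadratic_nonneg_discriminant)
  fix t :: real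
  have "0 \<le> (u + t \<cdot>\<^sub>v v) \<bullet> (M *\<^sub>v (u + t \<cdot>\<^sub>v v))"
    using u v by (intro psd) auto
  also have "\<dots> = u \<bullet> (M *\<^sub>v u) + t * (u \<bullet> (M *\<^sub>v v)) + (t * (v \<bullet> (M *\<^sub>v u)) + t * (t * (v \<bullet> (M *\<^sub>v v))))"
    using M u v
    by (simp add: mult_add_distrib_mat_vec[of _ n n] mult_mat_vec[of _ n n]
        add_scalar_prod_distrib[of _ n] scalar_prod_add_distrib[of _ n] algebra_simps)
  also have "v \<bullet> (M *\<^sub>v u) = u \<bullet> (M *\<^sub>v v)" using sym_mat_scalar_prod[OF M v u] .
  finally show "0 \<le> u \<bullet> (M *\<^sub>v u) + 2 * (u \<bullet> (M *\<^sub>v v)) * t + v \<bullet> (M *\<^sub>v v) * t\<^sup>2"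
    by (simp add: power2_eq_square algebra_simps)
qed (rule psd[OF v])

lemma scalar_prod_le_enorm:
  assumes "u \<in> carrier_vec n" "v \<in> carrier_vec n"
  shows "\<bar>u \<bullet> v\<bar> \<le> enorm u * enorm v"
proof -
  have "(u \<bullet> v)\<^sup>2 \<le> (enorm u * enorm v)\<^sup>2"
    using psd_cauchy_schwarz[of "1\<^sub>m n" n u v] assms scalar_prod_self_nonneg
    by (simp add: power_mult_distrib enorm_power2)
  then show ?thesis
    using abs_le_square_iff[of "u \<bullet> v" "enorm u * enorm v"] by simp
qed

lemma enorm_triangle:
  assumes "u \<in> carrier_vec n" "v \<in> carrier_vec n"
  shows "enorm (u + v) \<le> enorm u + enorm v"
proof (rule power2_le_imp_le)
  have "(enorm (u + v))\<^sup>2 = u \<bullet> u + 2 * (u \<bullet> v) + v \<bullet> v"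
    using assms comm_scalar_prod[of u n v]
    by (simp add: enorm_power2 add_scalar_prod_distrib[of _ n] scalar_prod_add_distrib[of _ n])
  also have "\<dots> \<le> (enorm u + enorm v)\<^sup>2"
    using scalar_prod_le_enorm[OF assms] by (simp add: power2_sum enorm_power2)
  finally show "(enorm (u + v))\<^sup>2 \<le> (enorm u + enorm v)\<^sup>2" .
qed simp

text \<open>Cauchy-Schwarz row by row: \<open>sqrt C0\<close> is the Frobenius norm of
  \<open>M\<close>, and the added 1 keeps the constant positive for \<open>M = 0\<close>, so that
  one may divide by it.\<close>

lemma mult_mat_vec_bounded:
  fixes M :: "real mat"
  assumes M: "M \<in> carrier_mat nr nc"
  obtains C :: real where "0 < C" "\<And>v. v \<in> carrier_vec nc \<Longrightarrow> enorm (M *\<^sub>v v) \<le> C * enorm v"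
proof
  define C0 where "C0 = (\<Sum>i<nr. (enorm (row M i))\<^sup>2)"
  have C: "0 \<le> C0" by (simp add: C0_def sum_nonneg)
  then show "0 < 1 + sqrt C0" by (simp add: add_pos_nonneg)
  fix v :: "real vec" assume v: "v \<in> carrier_vec nc"
  have "(enorm (M *\<^sub>v v))\<^sup>2 = (\<Sum>i<nr. (row M i \<bullet> v)\<^sup>2)"
    using M unfolding enorm_power2 scalar_prod_def[of "M *\<^sub>v v" "M *\<^sub>v v"]
    by (simp add: power2_eq_square atLeast0LessThan)
  also have "\<dots> \<le> (\<Sum>i<nr. (enorm (row M i) * enorm v)\<^sup>2)"
  proof (rule sum_mono)
    fix i assume "i \<in> {..<nr}"
    have "\<bar>row M i \<bullet> v\<bar> \<le> enorm (row M i) * enorm v"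
      using M v by (intro scalar_prod_le_enorm[of _ nc]) auto
    then show "(row M i \<bullet> v)\<^sup>2 \<le> (enorm (row M i) * enorm v)\<^sup>2"
      using power_mono[of "\<bar>row M i \<bullet> v\<bar>" _ 2] by simp
  qed
  also have "\<dots> = (sqrt C0 * enorm v)\<^sup>2"
    unfolding power_mult_distrib sum_distrib_right[symmetric] C0_def[symmetric] using C by simp
  finally have "enorm (M *\<^sub>v v) \<le> sqrt C0 * enorm v"
    by (rule power2_le_imp_le) (simp add: C)
  also have "\<dots> \<le> (1 + sqrt C0) * enorm v" by (simp add: mult_right_mono)
  finally show "enorm (M *\<^sub>v v) \<le> (1 + sqrt C0) * enorm v" .
qed

text \<open>A real supremum carries information only for a set that is bounded above; this licenses
  each use of \<open>cSUP_upper\<close> for \<open>opnorm2\<close>.\<close>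

lemma bdd_above_opnorm2:
  "bdd_above ((\<lambda>x. enorm (M *\<^sub>v x)) ` {x \<in> carrier_vec (dim_col M). enorm x \<le> 1})"
proof -
  obtain C where C: "0 < C" "\<And>v. v \<in> carrier_vec (dim_col M) \<Longrightarrow> enorm (M *\<^sub>v v) \<le> C * enorm v"
    using mult_mat_vec_bounded[of M "dim_row M" "dim_col M"] by auto
  show ?thesis
  proof (rule bdd_aboveI2)
    fix x assume "x \<in> {x \<in> carrier_vec (dim_col M). enorm x \<le> 1}"
    then have "enorm (M *\<^sub>v x) \<le> C * enorm x" "C * enorm x \<le> C * 1"
      using C by (auto intro!: mult_left_mono simp del: mult_le_cancel_left1 mult_1_right)
    then show "enorm (M *\<^sub>v x) \<le> C * 1" by (rule order_trans)
  qed
qed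

lemma opnorm2_nonneg: "0 \<le> opnorm2 M"
proof -
  have "enorm (M *\<^sub>v 0\<^sub>v (dim_col M)) \<le> opnorm2 M"
    unfolding opnorm2_def by (rule cSUP_upper[OF _ bdd_above_opnorm2]) simp
  then show ?thesis using enorm_nonneg order_trans by blast
qed

text \<open>By homogeneity: rescaling a nonzero \<open>v\<close> to norm 1 puts it into the set over
  which the supremum is taken.\<close>

lemma enorm_mult_mat_vec_le:
  assumes M: "M \<in> carrier_mat nr nc" and v: "v \<in> carrier_vec nc"
  shows "enorm (M *\<^sub>v v) \<le> opnorm2 M * enorm v"
proof (cases "v = 0\<^sub>v nc")
  case True
  then show ?thesis using mult_mat_zero_vec[OF M] by simp
next
  case False
  then have pos: "enorm v > 0" using v enorm_pos by blast
  let ?w = "(1 / enorm v) \<cdot>\<^sub>v v"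
  have "enorm (M *\<^sub>v ?w) \<le> opnorm2 M"
    unfolding opnorm2_def using M v pos
    by (intro cSUP_upper[OF _ bdd_above_opnorm2]) (auto simp: enorm_smult)
  moreover have "enorm (M *\<^sub>v ?w) = enorm (M *\<^sub>v v) / enorm v"
    using M v pos by (simp add: mult_mat_vec[of _ nr nc] enorm_smult)
  ultimately show ?thesis using pos by (simp add: field_simps)
qed

text \<open>The matrix \<open>\<Delta>\<close> has this form. A unit vector attains the supremum,
  and one exists because \<open>0 < s\<close>.\<close>

lemma opnorm2_smult_one:
  assumes "0 < s" "0 \<le> c"
  shows "opnorm2 (c \<cdot>\<^sub>m 1\<^sub>m s) = c"
proof -
  have smult: "(c \<cdot>\<^sub>m 1\<^sub>m s) *\<^sub>v v = c \<cdot>\<^sub>v v" if "v \<in> carrier_vec s" for v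
    using that by (intro eq_vecI) auto
  have unit: "enorm (unit_vec s 0) = 1" "unit_vec s 0 \<in> carrier_vec s"
    using assms by (auto simp: enorm_def)
  show ?thesis
  proof (rule antisym)
    show "opnorm2 (c \<cdot>\<^sub>m 1\<^sub>m s) \<le> c"
      unfolding opnorm2_def
    proof (rule cSUP_least)
      show "{x \<in> carrier_vec (dim_col (c \<cdot>\<^sub>m 1\<^sub>m s)). enorm x \<le> 1} \<noteq> {}"
        using unit by (auto intro!: exI[of _ "unit_vec s 0"])
    qed (use assms in \<open>auto simp: smult enorm_smult mult_left_le\<close>)
    have "enorm ((c \<cdot>\<^sub>m 1\<^sub>m s) *\<^sub>v unit_vec s 0) \<le> opnorm2 (c \<cdot>\<^sub>m 1\<^sub>m s) * enorm (unit_vec s 0)"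
      by (rule enorm_mult_mat_vec_le[of _ s s]) auto
    then show "c \<le> opnorm2 (c \<cdot>\<^sub>m 1\<^sub>m s)"
      using assms smult[OF unit(2)] by (simp add: unit enorm_smult)
  qed
qed

section \<open>Positive definite matrices\<close>

lemma pos_def_carrier: "pos_def n M \<Longrightarrow> M \<in> carrier_mat n n"
  and pos_def_transpose: "pos_def n M \<Longrightarrow> transpose_mat M = M"
  and pos_def_pos: "pos_def n M \<Longrightarrow> x \<in> carrier_vec n \<Longrightarrow> x \<noteq> 0\<^sub>v n \<Longrightarrow> 0 < x \<bullet> (M *\<^sub>v x)"
  by (auto simp: pos_def_def)

lemma pos_def_nonneg: "pos_def n M \<Longrightarrow> x \<in> carrier_vec n \<Longrightarrow> 0 \<le> x \<bullet> (M *\<^sub>v x)"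
proof (cases "x = 0\<^sub>v n")
  case True
  assume "pos_def n M"
  then show ?thesis using True mult_mat_zero_vec[OF pos_def_carrier] by simp
qed (use pos_def_pos in \<open>auto simp: less_imp_le\<close>)

text \<open>A nonzero kernel vector would annihilate the form, so \<open>det M\<close> is nonzero,
  \<open>mat_inverse\<close> succeeds and \<open>the\<close> in \<open>minv\<close> returns the true
  inverse.\<close>

lemma minv_pos_def:
  assumes M: "pos_def n M"
  shows minv_carrier: "minv M \<in> carrier_mat n n"
    and minv_right: "M * minv M = 1\<^sub>m n"
    and minv_left: "minv M * M = 1\<^sub>m n"
proof -
  have cM: "M \<in> carrier_mat n n" using M by (rule pos_def_carrier)
  have "det M \<noteq> 0"
  proof
    assume "det M = 0"
    then obtain v where v: "v \<in> carrier_vec n" "v \<noteq> 0\<^sub>v n" "M *\<^sub>v v = 0\<^sub>v n"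
      using det_0_iff_vec_prod_zero[OF cM] by blast
    then show False using pos_def_pos[OF M v(1,2)] by simp
  qed
  then obtain N where "mat_inverse M = Some N"
    using mat_inverse(1)[OF cM, where b = "()"] det_non_zero_imp_unit[OF cM, where b = "()"]
    by (cases "mat_inverse M") auto
  then show "minv M \<in> carrier_mat n n" "M * minv M = 1\<^sub>m n" "minv M * M = 1\<^sub>m n"
    using mat_inverse(2)[OF cM] by (auto simp: minv_def)
qed

text \<open>Symmetry of \<open>M\<close> makes the transpose of \<open>minv M\<close> a left inverse
  of \<open>M\<close>, and a left inverse coincides with the right inverse
  \<open>minv M\<close>.\<close>

lemma minv_transpose:
  assumes M: "pos_def n M"
  shows "transpose_mat (minv M) = minv M"
proof -
  note [simp] = pos_def_carrier[OF M] minv_carrier[OF M]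
  have "transpose_mat (minv M) = transpose_mat (minv M) * (M * minv M)"
    using transpose_carrier_mat minv_carrier[OF M]
    by (simp add: minv_right[OF M] right_mult_one_mat[of _ n n])
  also have "\<dots> = (transpose_mat (minv M) * transpose_mat M) * minv M"
    by (simp add: pos_def_transpose[OF M] assoc_mult_mat[of _ n n _ n _ n])
  also have "transpose_mat (minv M) * transpose_mat M = transpose_mat (M * minv M)"
    by (rule transpose_mult[symmetric, of _ n n _ n]) auto
  finally show ?thesis using minv_carrier[OF M] by (simp add: minv_right[OF M] left_mult_one_mat[of _ n n])
qed

lemma mult_minv_vec:
  assumes M: "pos_def n M" and x: "x \<in> carrier_vec n"
  shows "M *\<^sub>v (minv M *\<^sub>v x) = x" "minv M *\<^sub>v (M *\<^sub>v x) = x"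
proof -
  note c = pos_def_carrier[OF M] minv_carrier[OF M]
  show "M *\<^sub>v (minv M *\<^sub>v x) = x"
    using assoc_mult_mat_vec[OF c x] x by (simp add: minv_right[OF M])
  show "minv M *\<^sub>v (M *\<^sub>v x) = x"
    using assoc_mult_mat_vec[OF c(2,1) x] x by (simp add: minv_left[OF M])
qed

text \<open>Substituting \<open>x = M y\<close> turns the form of \<open>minv M\<close> at
  \<open>x\<close> into the form of \<open>M\<close> at \<open>y\<close>.\<close>

lemma pos_def_minv:
  assumes M: "pos_def n M"
  shows "pos_def n (minv M)"
  unfolding pos_def_def
proof (intro conjI ballI impI minv_carrier[OF M] minv_transpose[OF M])
  fix x :: "real vec" assume x: "x \<in> carrier_vec n" "x \<noteq> 0\<^sub>v n"
  let ?y = "minv M *\<^sub>v x"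
  have y: "?y \<in> carrier_vec n" using minv_carrier[OF M] x by simp
  have "?y \<noteq> 0\<^sub>v n"
    using mult_minv_vec(1)[OF M x(1)] mult_mat_zero_vec[OF pos_def_carrier[OF M]] x(2) by auto
  then have "0 < ?y \<bullet> (M *\<^sub>v ?y)" using pos_def_pos[OF M y] by simp
  then show "0 < x \<bullet> ?y"
    using mult_minv_vec(1)[OF M x(1)] comm_scalar_prod[OF x(1) y] by simp
qed

text \<open>Cauchy-Schwarz for the form of \<open>M\<close>, applied to \<open>v\<close> and \<open>M\<^sup>-\<^sup>1 v\<close>, replaces the compactness
  of the unit sphere.\<close>

lemma pos_def_coercive:
  assumes M: "pos_def n M"
  obtains c where "0 < c" "\<And>v. v \<in> carrier_vec n \<Longrightarrow> c * (enorm v)\<^sup>2 \<le> v \<bullet> (M *\<^sub>v v)"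
proof -
  obtain C where C: "0 < C" "\<And>v. v \<in> carrier_vec n \<Longrightarrow> enorm (minv M *\<^sub>v v) \<le> C * enorm v"
    using mult_mat_vec_bounded[OF minv_carrier[OF M]] by blast
  have "1 / C * (enorm v)\<^sup>2 \<le> v \<bullet> (M *\<^sub>v v)" if v: "v \<in> carrier_vec n" for v
  proof (cases "v = 0\<^sub>v n")
    case True
    then show ?thesis using pos_def_nonneg[OF M v] by simp
  next
    case False
    let ?w = "minv M *\<^sub>v v"
    have w: "?w \<in> carrier_vec n" using minv_carrier[OF M] v by simp
    have pos: "0 < (enorm v)\<^sup>2" using enorm_pos[OF v False] by simp
    have "((enorm v)\<^sup>2)\<^sup>2 = (v \<bullet> (M *\<^sub>v ?w))\<^sup>2"
      using mult_minv_vec(1)[OF M v] by (simp add: enorm_power2)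
    also have "\<dots> \<le> (v \<bullet> (M *\<^sub>v v)) * (?w \<bullet> v)"
      using psd_cauchy_schwarz[OF pos_def_carrier[OF M] pos_def_transpose[OF M] pos_def_nonneg[OF M] v w]
        mult_minv_vec(1)[OF M v] by simp
    also have "\<dots> \<le> (v \<bullet> (M *\<^sub>v v)) * (C * (enorm v)\<^sup>2)"
    proof (rule mult_left_mono)
      have "?w \<bullet> v \<le> enorm ?w * enorm v" using scalar_prod_le_enorm[OF w v] by simp
      also have "\<dots> \<le> C * enorm v * enorm v" using C(2)[OF v] by (simp add: mult_right_mono)
      finally show "?w \<bullet> v \<le> C * (enorm v)\<^sup>2" by (simp add: power2_eq_square)
    qed (rule pos_def_nonneg[OF M v])
    finally have "(enorm v)\<^sup>2 * (enorm v)\<^sup>2 \<le> (C * (v \<bullet> (M *\<^sub>v v))) * (enorm v)\<^sup>2"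
      by (simp add: power2_eq_square algebra_simps)
    then have "(enorm v)\<^sup>2 \<le> C * (v \<bullet> (M *\<^sub>v v))"
      using pos by (simp only: mult_le_cancel_right_pos)
    then show ?thesis using C(1) by (simp add: field_simps)
  qed
  then show ?thesis using C(1) by (intro that[of "1 / C"]) auto
qed

section \<open>Data matrices\<close>

text \<open>A matrix and its transpose have the same operator norm: bound
  \<open>|M v|^2 = (M^T M v) \<bullet> v\<close> by Cauchy-Schwarz and cancel one factor
  \<open>|M v|\<close>. The samples bound the transpose of the disturbance matrix, while the
  remainder estimates use the matrix itself.\<close>

lemma enorm_mult_le_of_transpose:
  assumes M: "M \<in> carrier_mat nr nc" and "0 \<le> \<rho>"
    and tr: "\<And>w. w \<in> carrier_vec nr \<Longrightarrow> enorm (transpose_mat M *\<^sub>v w) \<le> \<rho> * enorm w"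
    and v: "v \<in> carrier_vec nc"
  shows "enorm (M *\<^sub>v v) \<le> \<rho> * enorm v"
proof -
  have Mv: "M *\<^sub>v v \<in> carrier_vec nr" using M v by simp
  have "(enorm (M *\<^sub>v v))\<^sup>2 = (transpose_mat M *\<^sub>v (M *\<^sub>v v)) \<bullet> v"
    using transpose_vec_mult_scalar[OF M v Mv] by (simp add: enorm_power2)
  also have "\<dots> \<le> enorm (transpose_mat M *\<^sub>v (M *\<^sub>v v)) * enorm v"
    using scalar_prod_le_enorm[of "transpose_mat M *\<^sub>v (M *\<^sub>v v)" nc v] M v by auto
  also have "\<dots> \<le> (\<rho> * enorm (M *\<^sub>v v)) * enorm v"
    using tr[OF Mv] by (simp add: mult_right_mono)
  finally have *: "enorm (M *\<^sub>v v) * enorm (M *\<^sub>v v) \<le> (\<rho> * enorm v) * enorm (M *\<^sub>v v)"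
    by (simp add: power2_eq_square algebra_simps)
  show ?thesis
  proof (cases "enorm (M *\<^sub>v v) = 0")
    case True
    then show ?thesis using \<open>0 \<le> \<rho>\<close> by simp
  next
    case False
    then have "0 < enorm (M *\<^sub>v v)" using enorm_nonneg[of "M *\<^sub>v v"] by linarith
    then show ?thesis using * by (simp only: mult_le_cancel_right_pos)
  qed
qed

lemma data_mat_carrier [simp]: "data_mat r T w \<in> carrier_mat r T"
  and data_mat_index: "i < r \<Longrightarrow> k < T \<Longrightarrow> data_mat r T w $$ (i, k) = w k $ i"
  by (auto simp: data_mat_def mat_of_cols_index mat_of_cols_carrier)

lemma data_mat_col: "k < T \<Longrightarrow> w k \<in> carrier_vec r \<Longrightarrow> col (data_mat r T w) k = w k"
  by (simp add: data_mat_def)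

text \<open>The entries of the product are the \<open>T\<close> numbers
  \<open>w k \<bullet> v\<close>, each at most \<open>b |v|\<close> in modulus. Summing their
  squares is the origin of the factor \<open>sqrt T\<close> in \<open>\<Delta>\<close>.\<close>

lemma data_mat_transpose_bound:
  assumes w: "\<And>k. k < T \<Longrightarrow> w k \<in> carrier_vec r" and bound: "\<And>k. k < T \<Longrightarrow> enorm (w k) \<le> b"
    and "0 \<le> b" and v: "v \<in> carrier_vec r"
  shows "enorm (transpose_mat (data_mat r T w) *\<^sub>v v) \<le> b * sqrt T * enorm v"
proof -
  have dim: "dim_row (data_mat r T w) = r" "dim_col (data_mat r T w) = T"
    using data_mat_carrier[of r T w] by (auto simp del: data_mat_carrier)
  have "(enorm (transpose_mat (data_mat r T w) *\<^sub>v v))\<^sup>2 = (\<Sum>k<T. (w k \<bullet> v)\<^sup>2)"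
    unfolding enorm_power2 scalar_prod_def[of "_ *\<^sub>v _" "_ *\<^sub>v _"]
    by (simp add: dim data_mat_col w power2_eq_square atLeast0LessThan)
  also have "\<dots> \<le> (\<Sum>k<T. (b * enorm v)\<^sup>2)"
  proof (rule sum_mono)
    fix k assume k: "k \<in> {..<T}"
    have "\<bar>w k \<bullet> v\<bar> \<le> enorm (w k) * enorm v"
      using k by (intro scalar_prod_le_enorm[of _ r] w v) auto
    also have "\<dots> \<le> b * enorm v" using k bound by (simp add: mult_right_mono)
    finally show "(w k \<bullet> v)\<^sup>2 \<le> (b * enorm v)\<^sup>2"
      using power_mono[of "\<bar>w k \<bullet> v\<bar>" _ 2] by simp
  qed
  also have "\<dots> = (b * sqrt T * enorm v)\<^sup>2"
    by (simp add: power_mult_distrib)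
  finally show ?thesis by (rule power2_le_imp_le) (simp add: \<open>0 \<le> b\<close>)
qed

section \<open>The linear matrix inequality\<close>

text \<open>The lower blocks have no rows, so the block product carries only an extra part of length
  zero.\<close>

lemma append_cols_mult_vec:
  fixes M N :: "real mat"
  assumes M: "M \<in> carrier_mat r c1" and N: "N \<in> carrier_mat r c2"
    and a: "a \<in> carrier_vec c1" and b: "b \<in> carrier_vec c2"
  shows "(M @\<^sub>c N) *\<^sub>v (a @\<^sub>v b) = M *\<^sub>v a + N *\<^sub>v b"
proof -
  have "(M @\<^sub>c N) *\<^sub>v (a @\<^sub>v b) = (M *\<^sub>v a + N *\<^sub>v b) @\<^sub>v (0\<^sub>m 0 c1 *\<^sub>v a + 0\<^sub>m 0 c2 *\<^sub>v b)"
    unfolding append_cols_def using M N a b by (subst four_block_mat_mult_vec[of _ r c1 _ c2 _ 0]) auto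
  also have "\<dots> = M *\<^sub>v a + N *\<^sub>v b"
    using M N by (intro eq_vecI) auto
  finally show ?thesis .
qed

lemma append_cols_carrier:
  "M \<in> carrier_mat r c1 \<Longrightarrow> N \<in> carrier_mat r c2 \<Longrightarrow> M @\<^sub>c N \<in> carrier_mat r (c1 + c2)"
  unfolding append_cols_def by auto

text \<open>The test vector is nested like the blocks of the matrix. Mutually transposed
  off-diagonal blocks contribute equal terms, hence the factors 2, and the zero blocks leave no
  product of \<open>w\<close> and \<open>z\<close>.\<close>

lemma lmi_block_form:
  fixes A N R Y :: "real mat"
  assumes A: "A \<in> carrier_mat n n" and N: "N \<in> carrier_mat n n" and R: "R \<in> carrier_mat n n"
    and Y: "Y \<in> carrier_mat T n"
    and p: "p \<in> carrier_vec n" and w: "w \<in> carrier_vec n" and z: "z \<in> carrier_vec T"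
  shows "((p @\<^sub>v w) @\<^sub>v z) \<bullet> (four_block_mat (four_block_mat A (transpose_mat N) N R)
      (transpose_mat Y @\<^sub>r 0\<^sub>m n T) (Y @\<^sub>c 0\<^sub>m T n) (\<epsilon> \<cdot>\<^sub>m 1\<^sub>m T) *\<^sub>v ((p @\<^sub>v w) @\<^sub>v z)) =
    p \<bullet> (A *\<^sub>v p) + 2 * (w \<bullet> (N *\<^sub>v p)) + w \<bullet> (R *\<^sub>v w) + 2 * (z \<bullet> (Y *\<^sub>v p)) + \<epsilon> * (z \<bullet> z)"
proof -
  have Nt: "transpose_mat N \<in> carrier_mat n n" and Yt: "transpose_mat Y \<in> carrier_mat n T"
    using N Y by auto
  have b1: "four_block_mat A (transpose_mat N) N R \<in> carrier_mat (n + n) (n + n)"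
    using A R by auto
  have b2: "transpose_mat Y @\<^sub>r 0\<^sub>m n T \<in> carrier_mat (n + n) T" using Yt by auto
  have b3: "Y @\<^sub>c 0\<^sub>m T n \<in> carrier_mat T (n + n)" by (rule append_cols_carrier[OF Y]) simp
  have I: "(\<epsilon> \<cdot>\<^sub>m 1\<^sub>m T) *\<^sub>v z = \<epsilon> \<cdot>\<^sub>v z" using z by (intro eq_vecI) auto
  have "four_block_mat (four_block_mat A (transpose_mat N) N R)
      (transpose_mat Y @\<^sub>r 0\<^sub>m n T) (Y @\<^sub>c 0\<^sub>m T n) (\<epsilon> \<cdot>\<^sub>m 1\<^sub>m T) *\<^sub>v ((p @\<^sub>v w) @\<^sub>v z) =
    (((A *\<^sub>v p + transpose_mat N *\<^sub>v w) @\<^sub>v (N *\<^sub>v p + R *\<^sub>v w)) + (transpose_mat Y *\<^sub>v z @\<^sub>v 0\<^sub>v n)) @\<^sub>v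
      (Y *\<^sub>v p + 0\<^sub>v T + \<epsilon> \<cdot>\<^sub>v z)"
    using p w z
    by (simp add: four_block_mat_mult_vec[OF b1 b2 b3, of "\<epsilon> \<cdot>\<^sub>m 1\<^sub>m T"]
        four_block_mat_mult_vec[OF A Nt N R] mat_mult_append[OF Yt, of _ n]
        append_cols_mult_vec[OF Y, of _ n] zero_mult_mat_vec I)
  also have "((p @\<^sub>v w) @\<^sub>v z) \<bullet> \<dots> =
     (p \<bullet> (A *\<^sub>v p) + p \<bullet> (transpose_mat N *\<^sub>v w) + (w \<bullet> (N *\<^sub>v p) + w \<bullet> (R *\<^sub>v w)) + p \<bullet> (transpose_mat Y *\<^sub>v z)) +
     (z \<bullet> (Y *\<^sub>v p) + \<epsilon> * (z \<bullet> z))"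
    using assms Nt Yt
    by (simp add: scalar_prod_append[of _ "n + n" _ T] scalar_prod_append[of _ n _ n]
        scalar_prod_add_distrib[of _ n] scalar_prod_add_distrib[of _ T] scalar_prod_add_distrib[of _ "n + n"])
  also have "p \<bullet> (transpose_mat N *\<^sub>v w) = w \<bullet> (N *\<^sub>v p)"
    using transpose_vec_mult_scalar[OF N p w] comm_scalar_prod[OF p, of "transpose_mat N *\<^sub>v w"] Nt w by simp
  also have "p \<bullet> (transpose_mat Y *\<^sub>v z) = z \<bullet> (Y *\<^sub>v p)"
    using transpose_vec_mult_scalar[OF Y p z] comm_scalar_prod[OF p, of "transpose_mat Y *\<^sub>v z"] Yt z by simp
  finally show ?thesis by simp
qed

text \<open>Petersen's lemma in the direction needed: the matrix inequality, tested at
  \<open>w = - P1\<^sup>-\<^sup>1 q\<close> and \<open>z = - D\<^sup>T w\<close>, gives a decrease that is uniform in the uncertainty \<open>D\<close>.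
  The strictness of the matrix inequality leaves the margin \<open>c\<close>.\<close>

lemma lmi_decrease:
  fixes P1 \<Omega> N F Y :: "real mat"
  assumes P1: "pos_def n P1" and \<Omega>: "\<Omega> \<in> carrier_mat n n" and N: "N \<in> carrier_mat n n"
    and F: "F \<in> carrier_mat n n" and Y: "Y \<in> carrier_mat T n" and \<epsilon>: "0 \<le> \<epsilon>"
    and lmi: "pos_def (n + n + T)
       (four_block_mat (four_block_mat (P1 - \<Omega>) (transpose_mat N) N (P1 - \<epsilon> \<cdot>\<^sub>m F))
         (transpose_mat Y @\<^sub>r 0\<^sub>m n T) (Y @\<^sub>c 0\<^sub>m T n) (\<epsilon> \<cdot>\<^sub>m 1\<^sub>m T))"
  obtains c where "0 < c"
    "\<And>D p. D \<in> carrier_mat n T \<Longrightarrow>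
      (\<And>w. w \<in> carrier_vec n \<Longrightarrow> (enorm (transpose_mat D *\<^sub>v w))\<^sup>2 \<le> w \<bullet> (F *\<^sub>v w)) \<Longrightarrow>
      p \<in> carrier_vec n \<Longrightarrow>
      (N *\<^sub>v p - D *\<^sub>v (Y *\<^sub>v p)) \<bullet> (minv P1 *\<^sub>v (N *\<^sub>v p - D *\<^sub>v (Y *\<^sub>v p)))
        + p \<bullet> (\<Omega> *\<^sub>v p) + c * (enorm p)\<^sup>2 \<le> p \<bullet> (P1 *\<^sub>v p)"
proof -
  let ?big = "four_block_mat (four_block_mat (P1 - \<Omega>) (transpose_mat N) N (P1 - \<epsilon> \<cdot>\<^sub>m F))
         (transpose_mat Y @\<^sub>r 0\<^sub>m n T) (Y @\<^sub>c 0\<^sub>m T n) (\<epsilon> \<cdot>\<^sub>m 1\<^sub>m T)"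
  \<comment> \<open>Coercivity is invoked before \<open>D\<close> and \<open>p\<close> are fixed, so
    the margin depends on neither.\<close>
  obtain c where c: "0 < c"
    "\<And>v. v \<in> carrier_vec (n + n + T) \<Longrightarrow> c * (enorm v)\<^sup>2 \<le> v \<bullet> (?big *\<^sub>v v)"
    using pos_def_coercive[OF lmi] by blast
  note cP1 = pos_def_carrier[OF P1]
  show ?thesis
  proof (rule that[OF c(1)])
    fix D :: "real mat" and p :: "real vec"
    assume D: "D \<in> carrier_mat n T" and p: "p \<in> carrier_vec n"
      and DF: "\<And>w. w \<in> carrier_vec n \<Longrightarrow> (enorm (transpose_mat D *\<^sub>v w))\<^sup>2 \<le> w \<bullet> (F *\<^sub>v w)"
    define q where "q = N *\<^sub>v p - D *\<^sub>v (Y *\<^sub>v p)"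
    \<comment> \<open>This \<open>w\<close> minimises
      \<open>2 (w \<bullet> q) + w \<bullet> (P1 w)\<close>, and the minimum is minus the form of
      \<open>minv P1\<close> at \<open>q\<close>: a Schur complement carried out on vectors.\<close>
    define w where "w = - 1 \<cdot>\<^sub>v (minv P1 *\<^sub>v q)"
    \<comment> \<open>With this \<open>z\<close> the cross term with \<open>Y p\<close> turns
      \<open>w \<bullet> (N p)\<close> into \<open>w \<bullet> q\<close>, while
      \<open>\<epsilon> (z \<bullet> z)\<close> is dominated by the term
      \<open>\<epsilon> (w \<bullet> (F w))\<close> that the matrix inequality subtracts.\<close>
    define z where "z = - 1 \<cdot>\<^sub>v (transpose_mat D *\<^sub>v w)"
    have Yp: "Y *\<^sub>v p \<in> carrier_vec T" and Np: "N *\<^sub>v p \<in> carrier_vec n"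
      using Y N p by auto
    have DYp: "D *\<^sub>v (Y *\<^sub>v p) \<in> carrier_vec n" using D Yp by simp
    have q: "q \<in> carrier_vec n" unfolding q_def using Np DYp by simp
    have Pq: "minv P1 *\<^sub>v q \<in> carrier_vec n" using minv_carrier[OF P1] q by simp
    have w: "w \<in> carrier_vec n" unfolding w_def using Pq by simp
    have Dw: "transpose_mat D *\<^sub>v w \<in> carrier_vec T" using D w by simp
    have z: "z \<in> carrier_vec T" unfolding z_def using Dw by simp
    have zz: "z \<bullet> z \<le> w \<bullet> (F *\<^sub>v w)"
      using DF[OF w] Dw by (simp add: z_def enorm_power2)
    have zY: "z \<bullet> (Y *\<^sub>v p) = - (w \<bullet> (D *\<^sub>v (Y *\<^sub>v p)))"
      using transpose_vec_mult_scalar[OF D Yp w] Dw Yp by (simp add: z_def)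
    have Nq: "w \<bullet> (N *\<^sub>v p) - w \<bullet> (D *\<^sub>v (Y *\<^sub>v p)) = w \<bullet> q"
      unfolding q_def using scalar_prod_minus_distrib[OF w Np DYp] by simp
    have wq: "w \<bullet> q = - (q \<bullet> (minv P1 *\<^sub>v q))"
      using Pq q comm_scalar_prod[OF q Pq] by (simp add: w_def)
    have "P1 *\<^sub>v w = - 1 \<cdot>\<^sub>v q"
      unfolding w_def using mult_mat_vec[OF cP1 Pq] mult_minv_vec(1)[OF P1 q] by simp
    then have wP: "w \<bullet> (P1 *\<^sub>v w) = q \<bullet> (minv P1 *\<^sub>v q)"
      using wq w q by simp
    have R: "P1 - \<epsilon> \<cdot>\<^sub>m F \<in> carrier_mat n n" and A: "P1 - \<Omega> \<in> carrier_mat n n"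
      using cP1 F \<Omega> by (auto simp: minus_carrier_mat)
    have wR: "w \<bullet> ((P1 - \<epsilon> \<cdot>\<^sub>m F) *\<^sub>v w) = w \<bullet> (P1 *\<^sub>v w) - \<epsilon> * (w \<bullet> (F *\<^sub>v w))"
    proof -
      have "(\<epsilon> \<cdot>\<^sub>m F) *\<^sub>v w = \<epsilon> \<cdot>\<^sub>v (F *\<^sub>v w)" using F w by (intro eq_vecI) auto
      then show ?thesis
        using minus_mult_distrib_mat_vec[OF cP1, of "\<epsilon> \<cdot>\<^sub>m F" w]
          scalar_prod_minus_distrib[OF w, of "P1 *\<^sub>v w" "\<epsilon> \<cdot>\<^sub>v (F *\<^sub>v w)"] cP1 F w
        by simp
    qed
    have pA: "p \<bullet> ((P1 - \<Omega>) *\<^sub>v p) = p \<bullet> (P1 *\<^sub>v p) - p \<bullet> (\<Omega> *\<^sub>v p)"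
      using minus_mult_distrib_mat_vec[OF cP1 \<Omega> p]
        scalar_prod_minus_distrib[OF p, of "P1 *\<^sub>v p" "\<Omega> *\<^sub>v p"] cP1 \<Omega> p by simp
    let ?v = "(p @\<^sub>v w) @\<^sub>v z"
    have v: "?v \<in> carrier_vec (n + n + T)" using p w z by auto
    \<comment> \<open>The margin is measured in the whole test vector, of which \<open>p\<close> is
      one block.\<close>
    have "(enorm p)\<^sup>2 \<le> (enorm ?v)\<^sup>2"
      using p w z scalar_prod_self_nonneg[of w] scalar_prod_self_nonneg[of z]
      by (simp add: enorm_power2 scalar_prod_append[of _ "n + n" _ T] scalar_prod_append[of _ n _ n])
    then have "c * (enorm p)\<^sup>2 \<le> c * (enorm ?v)\<^sup>2" using c(1) by simp
    also have "\<dots> \<le> ?v \<bullet> (?big *\<^sub>v ?v)" by (rule c(2)[OF v])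
    also have "\<dots> = p \<bullet> ((P1 - \<Omega>) *\<^sub>v p) + 2 * (w \<bullet> (N *\<^sub>v p)) + w \<bullet> ((P1 - \<epsilon> \<cdot>\<^sub>m F) *\<^sub>v w)
        + 2 * (z \<bullet> (Y *\<^sub>v p)) + \<epsilon> * (z \<bullet> z)"
      by (rule lmi_block_form[OF A N R Y p w z])
    also have "\<dots> = p \<bullet> (P1 *\<^sub>v p) - p \<bullet> (\<Omega> *\<^sub>v p) + 2 * (w \<bullet> q) + q \<bullet> (minv P1 *\<^sub>v q)
        + \<epsilon> * (z \<bullet> z - w \<bullet> (F *\<^sub>v w))"
      unfolding Nq[symmetric] by (simp add: wR pA zY wP algebra_simps)
    also have "\<dots> \<le> p \<bullet> (P1 *\<^sub>v p) - p \<bullet> (\<Omega> *\<^sub>v p) - q \<bullet> (minv P1 *\<^sub>v q)"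
      using mult_nonneg_nonpos[OF \<epsilon>, of "z \<bullet> z - w \<bullet> (F *\<^sub>v w)"] zz by (simp add: wq)
    finally show "(N *\<^sub>v p - D *\<^sub>v (Y *\<^sub>v p)) \<bullet> (minv P1 *\<^sub>v (N *\<^sub>v p - D *\<^sub>v (Y *\<^sub>v p)))
        + p \<bullet> (\<Omega> *\<^sub>v p) + c * (enorm p)\<^sup>2 \<le> p \<bullet> (P1 *\<^sub>v p)"
      by (simp add: q_def)
  qed
qed

text \<open>The program asks only for a symmetric \<open>P1\<close>. Testing the matrix inequality
  at vectors whose last two blocks vanish shows that \<open>P1\<close> dominates
  \<open>\<Omega>\<close>, which makes \<open>minv P1\<close> meaningful.\<close>

lemma lmi_pos_def:
  fixes P1 \<Omega> N R Y :: "real mat"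
  assumes P1: "P1 \<in> carrier_mat n n" "transpose_mat P1 = P1" and \<Omega>: "pos_def n \<Omega>"
    and N: "N \<in> carrier_mat n n" and R: "R \<in> carrier_mat n n" and Y: "Y \<in> carrier_mat T n"
    and lmi: "pos_def (n + n + T)
       (four_block_mat (four_block_mat (P1 - \<Omega>) (transpose_mat N) N R)
         (transpose_mat Y @\<^sub>r 0\<^sub>m n T) (Y @\<^sub>c 0\<^sub>m T n) (\<epsilon> \<cdot>\<^sub>m 1\<^sub>m T))"
  shows "pos_def n P1"
  unfolding pos_def_def
proof (intro conjI ballI impI P1)
  fix p :: "real vec" assume p: "p \<in> carrier_vec n" "p \<noteq> 0\<^sub>v n"
  note c\<Omega> = pos_def_carrier[OF \<Omega>]
  have A: "P1 - \<Omega> \<in> carrier_mat n n" using c\<Omega> by (auto simp: minus_carrier_mat)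
  let ?v = "(p @\<^sub>v 0\<^sub>v n) @\<^sub>v 0\<^sub>v T"
  have v: "?v \<in> carrier_vec (n + n + T)" using p by auto
  have "0 \<le> ?v \<bullet> (four_block_mat (four_block_mat (P1 - \<Omega>) (transpose_mat N) N R)
         (transpose_mat Y @\<^sub>r 0\<^sub>m n T) (Y @\<^sub>c 0\<^sub>m T n) (\<epsilon> \<cdot>\<^sub>m 1\<^sub>m T) *\<^sub>v ?v)"
    by (rule pos_def_nonneg[OF lmi v])
  also have "\<dots> = p \<bullet> ((P1 - \<Omega>) *\<^sub>v p)"
    using lmi_block_form[OF A N R Y p(1) zero_carrier_vec zero_carrier_vec] N R Y p by simp
  also have "\<dots> = p \<bullet> (P1 *\<^sub>v p) - p \<bullet> (\<Omega> *\<^sub>v p)"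
    using minus_mult_distrib_mat_vec[OF P1(1) c\<Omega> p(1)]
      scalar_prod_minus_distrib[OF p(1), of "P1 *\<^sub>v p" "\<Omega> *\<^sub>v p"] P1 c\<Omega> p by simp
  finally show "0 < p \<bullet> (P1 *\<^sub>v p)" using pos_def_pos[OF \<Omega> p] by simp
qed

section \<open>Lyapunov functions\<close>

text \<open>Since \<open>V y\<close> is at most \<open>b |y|^2\<close>, a decrease by
  \<open>c |y|^2\<close> is a decrease by at least the fraction \<open>c / b\<close> of
  \<open>V y\<close>. Hence \<open>V\<close> decays geometrically, and its lower bound carries this
  over to the norm.\<close>

lemma lyapunov_decay:
  assumes ab: "0 < a" "0 < b" "0 < c" and R: "R \<subseteq> carrier_vec n"
    and V: "\<And>y. y \<in> R \<Longrightarrow> a * (enorm y)\<^sup>2 \<le> V y" "\<And>y. y \<in> R \<Longrightarrow> V y \<le> b * (enorm y)\<^sup>2"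
    and f: "\<And>y. y \<in> R \<Longrightarrow> f y \<in> R"
      "\<And>y. y \<in> R \<Longrightarrow> V (f y) \<le> V y - c * (enorm y)\<^sup>2"
    and x0: "x0 \<in> R"
  shows "(f ^^ t) x0 \<in> R" "tends_to_vec (\<lambda>t. (f ^^ t) x0) (0\<^sub>v n)"
proof -
  \<comment> \<open>The maximum with 0 keeps the factor nonnegative, so that the one-step bound can
    be iterated even if \<open>c > b\<close>.\<close>
  define \<theta> where "\<theta> = max 0 (1 - c / b)"
  have \<theta>: "0 \<le> \<theta>" "\<theta> < 1" using ab by (auto simp: \<theta>_def)
  have Vnn: "0 \<le> V y" if "y \<in> R" for y
    by (rule order_trans[OF _ V(1)[OF that]]) (use ab(1) in simp)
  have step: "V (f y) \<le> \<theta> * V y" if y: "y \<in> R" for y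
  proof -
    have "c / b * V y \<le> c * (enorm y)\<^sup>2"
      using V(2)[OF y] ab by (simp add: field_simps)
    then have "V (f y) \<le> (1 - c / b) * V y" using f(2)[OF y] by (simp add: algebra_simps)
    also have "\<dots> \<le> \<theta> * V y" using Vnn[OF y] by (intro mult_right_mono) (auto simp: \<theta>_def)
    finally show ?thesis .
  qed
  have iter: "(f ^^ t) x0 \<in> R \<and> V ((f ^^ t) x0) \<le> \<theta> ^ t * V x0" for t
  proof (induction t)
    case (Suc t)
    then have "V (f ((f ^^ t) x0)) \<le> \<theta> * (\<theta> ^ t * V x0)"
      using step[of "(f ^^ t) x0"] mult_left_mono[OF _ \<theta>(1)] by (meson order_trans)
    then show ?case using Suc f(1) by (simp add: mult.assoc)
  qed (use x0 in simp)
  then show "(f ^^ t) x0 \<in> R" by blast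
  have "enorm ((f ^^ t) x0 - 0\<^sub>v n) \<le> sqrt (\<theta> ^ t * V x0 / a)" for t
  proof -
    let ?x = "(f ^^ t) x0"
    have "?x \<in> carrier_vec n" using iter R by blast
    moreover have "a * (enorm ?x)\<^sup>2 \<le> \<theta> ^ t * V x0"
      using iter[of t] V(1)[of ?x] by simp
    ultimately show ?thesis using ab(1) by (intro real_le_rsqrt) (simp add: field_simps)
  qed
  moreover have "(\<lambda>t. sqrt (\<theta> ^ t * V x0 / a)) \<longlonglongrightarrow> sqrt (0 * V x0 / a)"
    using \<theta> ab(1) by (intro tendsto_intros LIMSEQ_power_zero) auto
  then have "(\<lambda>t. sqrt (\<theta> ^ t * V x0 / a)) \<longlonglongrightarrow> 0" by simp
  ultimately show "tends_to_vec (\<lambda>t. (f ^^ t) x0) (0\<^sub>v n)"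
    unfolding tends_to_vec_def 
    by - (rule real_tendsto_sandwich[where f = "\<lambda>_. 0" and h = "\<lambda>t. sqrt (\<theta> ^ t * V x0 / a)"], simp_all)
qed

text \<open>The decrease is known only in a ball of radius \<open>r\<close>, so
  \<open>lyapunov_decay\<close> is applied to a sublevel set inside that ball.\<close>

lemma lyapunov_asymptotically_stable:
  assumes ab: "0 < a" "0 < b" "0 < c" "0 < r"
    and V: "\<And>y. y \<in> carrier_vec n \<Longrightarrow> a * (enorm y)\<^sup>2 \<le> V y"
      "\<And>y. y \<in> carrier_vec n \<Longrightarrow> V y \<le> b * (enorm y)\<^sup>2"
    and f: "\<And>y. y \<in> carrier_vec n \<Longrightarrow> f y \<in> carrier_vec n" "f (0\<^sub>v n) = 0\<^sub>v n"
    and decr: "\<And>y. y \<in> carrier_vec n \<Longrightarrow> enorm y < r \<Longrightarrow> V (f y) \<le> V y - c * (enorm y)\<^sup>2"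
  shows "asymptotically_stable_equilibrium n f (0\<^sub>v n)"
proof -
  \<comment> \<open>Both halves of the definition follow from this: stability with
    \<open>min e r\<close> in place of \<open>e\<close>, attraction with \<open>r\<close>.\<close>
  have key: "\<exists>\<rho>>0. \<forall>x0\<in>carrier_vec n. enorm x0 < \<rho> \<longrightarrow>
      (\<forall>t. (f ^^ t) x0 \<in> carrier_vec n \<and> enorm ((f ^^ t) x0) < e) \<and>
      tends_to_vec (\<lambda>t. (f ^^ t) x0) (0\<^sub>v n)" if e: "0 < e" "e \<le> r" for e
  proof -
    \<comment> \<open>By the lower bound on \<open>V\<close> this sublevel set lies in the ball of
      radius \<open>e\<close>, hence where \<open>V\<close> decreases; so \<open>f\<close> maps it
      into itself.\<close>
    define R where "R = {y \<in> carrier_vec n. V y < a * e\<^sup>2}"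
    have small: "enorm y < e" if "y \<in> R" for y
    proof -
      have "a * (enorm y)\<^sup>2 < a * e\<^sup>2" using that V(1)[of y] by (simp add: R_def)
      then have "(enorm y)\<^sup>2 < e\<^sup>2" using ab(1) by simp
      then show ?thesis using e(1) by (intro power2_less_imp_less[of "enorm y" e]) auto
    qed
    have decrR: "V (f y) \<le> V y - c * (enorm y)\<^sup>2" if "y \<in> R" for y
      using decr[of y] small[OF that] e that by (simp add: R_def)
    have fR: "f y \<in> R" if y: "y \<in> R" for y
    proof -
      have "0 \<le> c * (enorm y)\<^sup>2" using ab(3) by simp
      then show ?thesis using decrR[OF y] y f(1) by (simp add: R_def)
    qed
    \<comment> \<open>By the upper bound on \<open>V\<close>, every point of norm below this radius
      starts in \<open>R\<close>.\<close>
    have "\<forall>x0\<in>carrier_vec n. enorm x0 < sqrt (a * e\<^sup>2 / b) \<longrightarrow>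
      (\<forall>t. (f ^^ t) x0 \<in> carrier_vec n \<and> enorm ((f ^^ t) x0) < e) \<and>
      tends_to_vec (\<lambda>t. (f ^^ t) x0) (0\<^sub>v n)"
    proof (intro ballI impI)
      fix x0 assume x0: "x0 \<in> carrier_vec n" and "enorm x0 < sqrt (a * e\<^sup>2 / b)"
      then have "(enorm x0)\<^sup>2 < (sqrt (a * e\<^sup>2 / b))\<^sup>2"
        by (intro power_strict_mono) auto
      then have "b * (enorm x0)\<^sup>2 < a * e\<^sup>2" using ab by (simp add: field_simps)
      then have "x0 \<in> R" using V(2)[OF x0] x0 by (simp add: R_def)
      moreover have "R \<subseteq> carrier_vec n" by (auto simp: R_def)
      ultimately have "\<And>t. (f ^^ t) x0 \<in> R" "tends_to_vec (\<lambda>t. (f ^^ t) x0) (0\<^sub>v n)"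
        using lyapunov_decay[OF ab(1-3), of R n V f x0] V fR decrR by (auto simp: subset_iff)
      then show "(\<forall>t. (f ^^ t) x0 \<in> carrier_vec n \<and> enorm ((f ^^ t) x0) < e) \<and>
          tends_to_vec (\<lambda>t. (f ^^ t) x0) (0\<^sub>v n)"
        using small \<open>R \<subseteq> carrier_vec n\<close> by blast
    qed
    moreover have "0 < sqrt (a * e\<^sup>2 / b)" using ab e by simp
    ultimately show ?thesis by blast
  qed
  show ?thesis
    unfolding asymptotically_stable_equilibrium_def
  proof (intro conjI allI impI)
    fix e :: real assume "0 < e"
    then obtain \<rho> where "\<rho> > 0" "\<And>x0 t. x0 \<in> carrier_vec n \<Longrightarrow> enorm x0 < \<rho> \<Longrightarrow>
        (f ^^ t) x0 \<in> carrier_vec n \<and> enorm ((f ^^ t) x0) < min e r"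
      using key[of "min e r"] ab(4) by auto
    then show "\<exists>\<rho>>0. \<forall>x0\<in>carrier_vec n. enorm (x0 - 0\<^sub>v n) < \<rho> \<longrightarrow>
        (\<forall>t. enorm ((f ^^ t) x0 - 0\<^sub>v n) < e)"
      by (intro exI[of _ \<rho>]) (auto simp: minus_zero_vec[of _ n])
  next
    obtain \<rho> where "\<rho> > 0" "\<And>x0. x0 \<in> carrier_vec n \<Longrightarrow> enorm x0 < \<rho> \<Longrightarrow>
        tends_to_vec (\<lambda>t. (f ^^ t) x0) (0\<^sub>v n)"
      using key[of r] ab(4) by auto
    then show "\<exists>\<rho>>0. \<forall>x0\<in>carrier_vec n. enorm (x0 - 0\<^sub>v n) < \<rho> \<longrightarrow>
        tends_to_vec (\<lambda>t. (f ^^ t) x0) (0\<^sub>v n)"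
      by (intro exI[of _ \<rho>]) auto
  qed (use f in auto)
qed

text \<open>The little-o condition in epsilon-delta form. The filter is punctured, so the origin is
  excluded here and has to be treated separately.\<close>

lemma norm_to_0_small:
  assumes lim: "((\<lambda>y. g y / enorm y) \<longlongrightarrow> 0) (norm_to_0 n)" and "0 < \<eta>"
  obtains r where "0 < r"
    "\<And>y. y \<in> carrier_vec n \<Longrightarrow> y \<noteq> 0\<^sub>v n \<Longrightarrow> enorm y < r \<Longrightarrow> g y \<le> \<eta> * enorm y"
proof -
  have "eventually (\<lambda>y. g y / enorm y < \<eta>) (norm_to_0 n)"
    using order_tendstoD(2)[OF lim \<open>0 < \<eta>\<close>] .
  then obtain P where P: "eventually P (at (0 :: real))"
    "\<And>y. P (enorm y) \<Longrightarrow> y \<in> carrier_vec n \<Longrightarrow> g y / enorm y < \<eta>"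
    unfolding norm_to_0_def eventually_inf_principal eventually_filtercomap by blast
  then obtain r where r: "0 < r" "\<And>t. t \<noteq> 0 \<Longrightarrow> \<bar>t\<bar> < r \<Longrightarrow> P t"
    unfolding eventually_at by (auto simp: dist_real_def)
  show ?thesis
  proof (rule that[OF r(1)])
    fix y assume y: "y \<in> carrier_vec n" "y \<noteq> 0\<^sub>v n" "enorm y < r"
    then have "0 < enorm y" using enorm_pos by blast
    moreover from this have "g y / enorm y < \<eta>" using P(2)[OF r(2)] y by simp
    ultimately show "g y \<le> \<eta> * enorm y" by (simp add: field_simps)
  qed
qed

section \<open>Increments of the Lyapunov function\<close>

text \<open>The grouping anticipates its use: the first term is handled by the matrix inequality,
  the second gives \<open>ell1\<close> to \<open>ell4\<close>, and the last two give
  \<open>gfun\<close>.\<close>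

lemma quadratic_form_sum3:
  fixes P :: "real mat"
  assumes P: "P \<in> carrier_mat n n" "transpose_mat P = P"
    and c: "a \<in> carrier_vec n" "b \<in> carrier_vec n" "c \<in> carrier_vec n"
  shows "(a + b + c) \<bullet> (P *\<^sub>v (a + b + c)) =
    a \<bullet> (P *\<^sub>v a) + (2 \<cdot>\<^sub>v a + b) \<bullet> (P *\<^sub>v b) + 2 * ((a + b) \<bullet> (P *\<^sub>v c)) + c \<bullet> (P *\<^sub>v c)"
proof -
  have [simp]: "P *\<^sub>v a \<in> carrier_vec n" "P *\<^sub>v b \<in> carrier_vec n" "P *\<^sub>v c \<in> carrier_vec n"
    using P c by auto
  show ?thesis
    using c sym_mat_scalar_prod[OF P c(2,1)] sym_mat_scalar_prod[OF P c(3,1)]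
      sym_mat_scalar_prod[OF P c(3,2)]
    by (simp add: mult_add_distrib_mat_vec[OF P(1)] add_scalar_prod_distrib[of _ n]
        scalar_prod_add_distrib[of _ n] algebra_simps)
qed

text \<open>In each case a matrix is moved to the other side by transposition before Cauchy-Schwarz.
  The three shapes produce the norms in \<open>ell2\<close> and \<open>r1\<close>, in
  \<open>ell3\<close>, and in \<open>ell4\<close>, \<open>r2\<close> and \<open>r3\<close>.\<close>

lemma quadratic_form_bounds:
  fixes P E :: "real mat"
  assumes P: "P \<in> carrier_mat n n" and E: "E \<in> carrier_mat n s"
    and w: "w \<in> carrier_vec n" and g: "g \<in> carrier_vec s" and h: "h \<in> carrier_vec s"
  shows "\<bar>w \<bullet> (P *\<^sub>v (E *\<^sub>v g))\<bar> \<le> enorm (transpose_mat (P * E) *\<^sub>v w) * enorm g"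
    and "\<bar>(E *\<^sub>v g) \<bullet> (P *\<^sub>v w)\<bar> \<le> enorm g * enorm (transpose_mat E *\<^sub>v (P *\<^sub>v w))"
    and "\<bar>(E *\<^sub>v g) \<bullet> (P *\<^sub>v (E *\<^sub>v h))\<bar> \<le> opnorm2 (transpose_mat E * P * E) * enorm g * enorm h"
proof -
  have PE: "P * E \<in> carrier_mat n s" and Et: "transpose_mat E \<in> carrier_mat s n"
    and PEt: "transpose_mat (P * E) \<in> carrier_mat s n"
    and EPE: "transpose_mat E * P * E \<in> carrier_mat s s"
    and Eg: "E *\<^sub>v g \<in> carrier_vec n" and Eh: "E *\<^sub>v h \<in> carrier_vec n"
    using P E g h by auto
  have "w \<bullet> (P *\<^sub>v (E *\<^sub>v g)) = (transpose_mat (P * E) *\<^sub>v w) \<bullet> g"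
    using transpose_vec_mult_scalar[OF PE g w] P E g by simp
  then show "\<bar>w \<bullet> (P *\<^sub>v (E *\<^sub>v g))\<bar> \<le> enorm (transpose_mat (P * E) *\<^sub>v w) * enorm g"
    using scalar_prod_le_enorm[of "transpose_mat (P * E) *\<^sub>v w" s g] PEt w g by simp
  have adj: "(E *\<^sub>v g) \<bullet> v = g \<bullet> (transpose_mat E *\<^sub>v v)" if v: "v \<in> carrier_vec n" for v
    using transpose_vec_mult_scalar[OF E g v] comm_scalar_prod[OF Eg v]
      comm_scalar_prod[OF g, of "transpose_mat E *\<^sub>v v"] Et v by simp
  have Pw: "P *\<^sub>v w \<in> carrier_vec n" and PEh: "P *\<^sub>v (E *\<^sub>v h) \<in> carrier_vec n" using P w Eh by auto
  show "\<bar>(E *\<^sub>v g) \<bullet> (P *\<^sub>v w)\<bar> \<le> enorm g * enorm (transpose_mat E *\<^sub>v (P *\<^sub>v w))"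
    unfolding adj[OF Pw] using Et Pw g by (intro scalar_prod_le_enorm[of _ s]) auto
  have "\<bar>(E *\<^sub>v g) \<bullet> (P *\<^sub>v (E *\<^sub>v h))\<bar> \<le> enorm g * enorm (transpose_mat E *\<^sub>v (P *\<^sub>v (E *\<^sub>v h)))"
    unfolding adj[OF PEh] using Et PEh g by (intro scalar_prod_le_enorm[of _ s]) auto
  also have "transpose_mat E *\<^sub>v (P *\<^sub>v (E *\<^sub>v h)) = (transpose_mat E * P * E) *\<^sub>v h"
    using assoc_mult_mat_vec[of "transpose_mat E * P" s n E s h] Et P E h Eh by simp
  also have "enorm g * enorm \<dots> \<le> enorm g * (opnorm2 (transpose_mat E * P * E) * enorm h)"
    by (intro mult_left_mono enorm_mult_mat_vec_le[OF EPE h]) simp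
  finally show "\<bar>(E *\<^sub>v g) \<bullet> (P *\<^sub>v (E *\<^sub>v h))\<bar> \<le> opnorm2 (transpose_mat E * P * E) * enorm g * enorm h"
    by (simp add: algebra_simps)
qed

text \<open>The unknown \<open>D\<close> is split off from every term except
  \<open>a \<bullet> (P a)\<close>, which is kept exact for the matrix inequality. In the
  application \<open>\<alpha>\<close>, \<open>\<beta>\<close> are the nominal parts
  \<open>X1 G1 y\<close>, \<open>X1 G2 Q(y)\<close>, and \<open>h\<close>, \<open>k\<close> are
  \<open>G1 y\<close>, \<open>G2 Q(y)\<close>.\<close>

lemma perturbed_quadratic_form_le:
  fixes P E D :: "real mat" and \<alpha> \<beta> h k e :: "real vec"
  assumes P: "P \<in> carrier_mat n n" "transpose_mat P = P" and E: "E \<in> carrier_mat n s"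
    and D: "D \<in> carrier_mat s T" and \<rho>: "0 \<le> \<rho>"
    and D_bound: "\<And>v. v \<in> carrier_vec T \<Longrightarrow> enorm (D *\<^sub>v v) \<le> \<rho> * enorm v"
    and \<alpha>: "\<alpha> \<in> carrier_vec n" and \<beta>: "\<beta> \<in> carrier_vec n"
    and h: "h \<in> carrier_vec T" and k: "k \<in> carrier_vec T"
    and e: "e \<in> carrier_vec s" "enorm e \<le> b"
  defines "a \<equiv> \<alpha> - E *\<^sub>v (D *\<^sub>v h)" and "a' \<equiv> \<beta> - E *\<^sub>v (D *\<^sub>v k)"
    and "M \<equiv> opnorm2 (transpose_mat E * P * E)"
  shows "(a + a' + E *\<^sub>v e) \<bullet> (P *\<^sub>v (a + a' + E *\<^sub>v e)) \<le> a \<bullet> (P *\<^sub>v a)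
    + (2 \<cdot>\<^sub>v \<alpha> + \<beta>) \<bullet> (P *\<^sub>v \<beta>)
    + \<rho> * enorm (transpose_mat (P * E) *\<^sub>v (2 \<cdot>\<^sub>v \<alpha> + \<beta>)) * enorm k
    + \<rho> * enorm (2 \<cdot>\<^sub>v h + k) * enorm (transpose_mat E *\<^sub>v (P *\<^sub>v \<beta>))
    + \<rho>\<^sup>2 * M * enorm (2 \<cdot>\<^sub>v h + k) * enorm k
    + (2 * enorm (transpose_mat (P * E) *\<^sub>v (\<alpha> + \<beta>)) * b + 2 * \<rho> * M * enorm (h + k) * b + M * b\<^sup>2)"
proof -
  define g where "g v = E *\<^sub>v (D *\<^sub>v v)" for v
  have Dc: "D *\<^sub>v v \<in> carrier_vec s" if "v \<in> carrier_vec T" for v using D that by simp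
  have g: "g v \<in> carrier_vec n" if "v \<in> carrier_vec T" for v
    unfolding g_def using E Dc[OF that] by simp
  have gl: "g (2 \<cdot>\<^sub>v h + k) = 2 \<cdot>\<^sub>v g h + g k" "g (h + k) = g h + g k"
    unfolding g_def using h k Dc[OF h] Dc[OF k]
    by (simp_all add: mult_add_distrib_mat_vec[OF D] mult_add_distrib_mat_vec[OF E]
        mult_mat_vec[OF D] mult_mat_vec[OF E])
  have hk: "2 \<cdot>\<^sub>v h + k \<in> carrier_vec T" "h + k \<in> carrier_vec T" using h k by auto
  have \<alpha>\<beta>: "2 \<cdot>\<^sub>v \<alpha> + \<beta> \<in> carrier_vec n" "\<alpha> + \<beta> \<in> carrier_vec n" using \<alpha> \<beta> by auto
  have a: "a \<in> carrier_vec n" and a': "a' \<in> carrier_vec n" and Ee: "E *\<^sub>v e \<in> carrier_vec n"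
    using \<alpha> \<beta> g[OF h] g[OF k] E e by (auto simp: a_def a'_def g_def)
  have b: "0 \<le> b" using e(2) enorm_nonneg[of e] by linarith
  have M: "0 \<le> M" unfolding M_def by (rule opnorm2_nonneg)
  have s1: "2 \<cdot>\<^sub>v a + a' = (2 \<cdot>\<^sub>v \<alpha> + \<beta>) - g (2 \<cdot>\<^sub>v h + k)"
    unfolding gl a_def a'_def g_def[symmetric] using \<alpha> \<beta> g[OF h] g[OF k] by (intro eq_vecI) auto
  have s2: "a + a' = (\<alpha> + \<beta>) - g (h + k)"
    unfolding gl a_def a'_def g_def[symmetric] using \<alpha> \<beta> g[OF h] g[OF k] by (intro eq_vecI) auto
  have Pc: "P *\<^sub>v v \<in> carrier_vec n" if "v \<in> carrier_vec n" for v using P that by simp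
  have e1: "(2 \<cdot>\<^sub>v a + a') \<bullet> (P *\<^sub>v a') =
      (2 \<cdot>\<^sub>v \<alpha> + \<beta>) \<bullet> (P *\<^sub>v \<beta>) - (2 \<cdot>\<^sub>v \<alpha> + \<beta>) \<bullet> (P *\<^sub>v g k)
      - g (2 \<cdot>\<^sub>v h + k) \<bullet> (P *\<^sub>v \<beta>) + g (2 \<cdot>\<^sub>v h + k) \<bullet> (P *\<^sub>v g k)"
  proof -
    have "P *\<^sub>v a' = P *\<^sub>v \<beta> - P *\<^sub>v g k"
      unfolding a'_def g_def[symmetric] by (rule mult_minus_distrib_mat_vec[OF P(1) \<beta> g[OF k]])
    then show ?thesis
      unfolding s1
      by (simp add: minus_scalar_prod_distrib[OF \<alpha>\<beta>(1) g[OF hk(1)]] Pc \<beta> g[OF k]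
          scalar_prod_minus_distrib[OF \<alpha>\<beta>(1)] scalar_prod_minus_distrib[OF g[OF hk(1)]])
  qed
  have e2: "(a + a') \<bullet> (P *\<^sub>v (E *\<^sub>v e)) = (\<alpha> + \<beta>) \<bullet> (P *\<^sub>v (E *\<^sub>v e)) - g (h + k) \<bullet> (P *\<^sub>v (E *\<^sub>v e))"
    unfolding s2 by (rule minus_scalar_prod_distrib[OF \<alpha>\<beta>(2) g[OF hk(2)] Pc[OF Ee]])
  note qf = quadratic_form_bounds[OF P(1) E]
  \<comment> \<open>The bounds \<open>t1\<close>, \<open>t2\<close>, \<open>t3\<close> become
    \<open>ell2\<close>, \<open>ell3\<close>, \<open>ell4\<close>; the bounds \<open>t4\<close>,
    \<open>t5\<close>, \<open>t6\<close> become the terms with \<open>r1\<close>, \<open>r2\<close>,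
    \<open>r3\<close>. The term free of both \<open>D\<close> and \<open>e\<close> becomes
    \<open>ell1\<close>.\<close>
  have t1: "\<bar>(2 \<cdot>\<^sub>v \<alpha> + \<beta>) \<bullet> (P *\<^sub>v g k)\<bar> \<le> \<rho> * enorm (transpose_mat (P * E) *\<^sub>v (2 \<cdot>\<^sub>v \<alpha> + \<beta>)) * enorm k"
    using order_trans[OF qf(1)[OF \<alpha>\<beta>(1) Dc[OF k] Dc[OF k]] mult_left_mono[OF D_bound[OF k] enorm_nonneg]]
    by (simp add: g_def algebra_simps)
  have t2: "\<bar>g (2 \<cdot>\<^sub>v h + k) \<bullet> (P *\<^sub>v \<beta>)\<bar> \<le> \<rho> * enorm (2 \<cdot>\<^sub>v h + k) * enorm (transpose_mat E *\<^sub>v (P *\<^sub>v \<beta>))"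
    using order_trans[OF qf(2)[OF \<beta> Dc[OF hk(1)] Dc[OF k]] mult_right_mono[OF D_bound[OF hk(1)] enorm_nonneg]]
    by (simp add: g_def)
  have t3: "\<bar>g (2 \<cdot>\<^sub>v h + k) \<bullet> (P *\<^sub>v g k)\<bar> \<le> \<rho>\<^sup>2 * M * enorm (2 \<cdot>\<^sub>v h + k) * enorm k"
  proof -
    have "\<bar>g (2 \<cdot>\<^sub>v h + k) \<bullet> (P *\<^sub>v g k)\<bar> \<le> M * (enorm (D *\<^sub>v (2 \<cdot>\<^sub>v h + k)) * enorm (D *\<^sub>v k))"
      using qf(3)[OF \<beta> Dc[OF hk(1)] Dc[OF k]] by (simp add: g_def M_def mult.assoc)
    also have "\<dots> \<le> M * ((\<rho> * enorm (2 \<cdot>\<^sub>v h + k)) * (\<rho> * enorm k))"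
      using M \<rho> by (intro mult_left_mono mult_mono D_bound hk k) auto
    finally show ?thesis by (simp add: power2_eq_square algebra_simps)
  qed
  have t4: "\<bar>(\<alpha> + \<beta>) \<bullet> (P *\<^sub>v (E *\<^sub>v e))\<bar> \<le> enorm (transpose_mat (P * E) *\<^sub>v (\<alpha> + \<beta>)) * b"
    using order_trans[OF qf(1)[OF \<alpha>\<beta>(2) e(1) e(1)] mult_left_mono[OF e(2) enorm_nonneg]] .
  have t5: "\<bar>g (h + k) \<bullet> (P *\<^sub>v (E *\<^sub>v e))\<bar> \<le> \<rho> * M * enorm (h + k) * b"
  proof -
    have "\<bar>g (h + k) \<bullet> (P *\<^sub>v (E *\<^sub>v e))\<bar> \<le> M * (enorm (D *\<^sub>v (h + k)) * enorm e)"
      using qf(3)[OF \<beta> Dc[OF hk(2)] e(1)] by (simp add: g_def M_def mult.assoc)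
    also have "\<dots> \<le> M * ((\<rho> * enorm (h + k)) * b)"
      using M \<rho> by (intro mult_left_mono mult_mono D_bound hk e) auto
    finally show ?thesis by (simp add: algebra_simps)
  qed
  have t6: "\<bar>(E *\<^sub>v e) \<bullet> (P *\<^sub>v (E *\<^sub>v e))\<bar> \<le> M * b\<^sup>2"
  proof -
    have "\<bar>(E *\<^sub>v e) \<bullet> (P *\<^sub>v (E *\<^sub>v e))\<bar> \<le> M * (enorm e * enorm e)"
      using qf(3)[OF \<beta> e(1) e(1)] by (simp add: M_def mult.assoc)
    also have "\<dots> \<le> M * (b * b)"
      using M b by (intro mult_left_mono mult_mono e) auto
    finally show ?thesis by (simp add: power2_eq_square)
  qed
  show ?thesis
    unfolding quadratic_form_sum3[OF P a a' Ee] e1 e2 using t1 t2 t3 t4 t5 t6 by (simp add: abs_le_iff)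
qed

section \<open>Data-driven closed loop\<close>

lemma data_mat_system:
  assumes A: "A \<in> carrier_mat n S" and B: "B \<in> carrier_mat n m" and E: "E \<in> carrier_mat n s"
    and z: "\<And>k. k < T \<Longrightarrow> z k \<in> carrier_vec S" and u: "\<And>k. k < T \<Longrightarrow> u k \<in> carrier_vec m"
    and w: "\<And>k. k < T \<Longrightarrow> w k \<in> carrier_vec s"
    and x: "\<And>k. k < T \<Longrightarrow> x (Suc k) = A *\<^sub>v z k + B *\<^sub>v u k + E *\<^sub>v w k"
  shows "data_mat n T (\<lambda>k. x (Suc k)) = A * data_mat S T z + B * data_mat m T u + E * data_mat s T w"
    (is "?L = ?R")
proof (rule eq_matI)
  have dim: "dim_row (data_mat r T v) = r" "dim_col (data_mat r T v) = T" for r v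
    using data_mat_carrier[of r T v] by (auto simp del: data_mat_carrier)
  show "dim_row ?L = dim_row ?R" "dim_col ?L = dim_col ?R" using E by (auto simp: dim)
  fix i k assume "i < dim_row ?R" "k < dim_col ?R"
  then have i: "i < n" and k: "k < T" using E by (auto simp: dim)
  show "?L $$ (i, k) = ?R $$ (i, k)"
    using A B E i k by (simp add: dim data_mat_index data_mat_col x z[OF k] u[OF k] w[OF k])
qed

text \<open>For \<open>\<zeta> = G1 y + G2 q\<close> the equality constraints give
  \<open>Z0 \<zeta> = (y, q)\<close>, and the gain gives the input \<open>U0 \<zeta>\<close>. So the
  closed loop is \<open>(A Z0 + B U0) \<zeta> = (X1 - E D0) \<zeta>\<close>, which eliminates the
  unknown \<open>A\<close> and \<open>B\<close>.\<close>

lemma closed_loop_representation: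
  fixes A B E X1 Z0 U0 D0 Y1 G1 G2 P1 :: "real mat"
  assumes A: "A \<in> carrier_mat n (n + k)" and B: "B \<in> carrier_mat n m" and E: "E \<in> carrier_mat n s"
    and Z0: "Z0 \<in> carrier_mat (n + k) T" and U0: "U0 \<in> carrier_mat m T" and D0: "D0 \<in> carrier_mat s T"
    and X1: "X1 = A * Z0 + B * U0 + E * D0"
    and Y1: "Y1 \<in> carrier_mat T n" and G2: "G2 \<in> carrier_mat T k"
    and P1: "pos_def n P1" and ZY: "Z0 * Y1 = P1 @\<^sub>r 0\<^sub>m k n" and ZG: "Z0 * G2 = 0\<^sub>m n k @\<^sub>r 1\<^sub>m k"
    and G1: "G1 = Y1 * minv P1"
    and y: "y \<in> carrier_vec n" and q: "q \<in> carrier_vec k"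
  shows "A *\<^sub>v (y @\<^sub>v q) + B * (U0 * (G1 @\<^sub>c G2)) *\<^sub>v (y @\<^sub>v q) =
    (X1 * G1 *\<^sub>v y - E *\<^sub>v (D0 *\<^sub>v (G1 *\<^sub>v y))) + (X1 * G2 *\<^sub>v q - E *\<^sub>v (D0 *\<^sub>v (G2 *\<^sub>v q)))"
proof -
  note P = minv_carrier[OF P1]
  have G1c: "G1 \<in> carrier_mat T n" unfolding G1 using Y1 P by simp
  have X1c: "X1 \<in> carrier_mat n T" unfolding X1 using A B E Z0 U0 D0 by auto
  have h: "G1 *\<^sub>v y \<in> carrier_vec T" and k: "G2 *\<^sub>v q \<in> carrier_vec T" using G1c G2 y q by auto
  define \<zeta> where "\<zeta> = G1 *\<^sub>v y + G2 *\<^sub>v q"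
  have \<zeta>: "\<zeta> \<in> carrier_vec T" unfolding \<zeta>_def using h k by simp
  have z: "y @\<^sub>v q \<in> carrier_vec (n + k)" using y q by simp
  have Py: "minv P1 *\<^sub>v y \<in> carrier_vec n" using P y by simp
  \<comment> \<open>Multiplied by \<open>minv P1\<close> from the right, the first equality
    constraint says that \<open>Z0 G1\<close> is the identity on top of zeros.\<close>
  have "Z0 *\<^sub>v (G1 *\<^sub>v y) = (Z0 * Y1) *\<^sub>v (minv P1 *\<^sub>v y)"
    unfolding G1 using Z0 Y1 P y Py by simp
  also have "\<dots> = y @\<^sub>v 0\<^sub>v k"
    unfolding ZY using mat_mult_append[OF pos_def_carrier[OF P1] zero_carrier_mat Py, of k] Py
    by (simp add: mult_minv_vec(1)[OF P1 y] zero_mult_mat_vec)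
  finally have Zh: "Z0 *\<^sub>v (G1 *\<^sub>v y) = y @\<^sub>v 0\<^sub>v k" .
  have "Z0 *\<^sub>v (G2 *\<^sub>v q) = (Z0 * G2) *\<^sub>v q" using Z0 G2 q by simp
  also have "\<dots> = 0\<^sub>v n @\<^sub>v q"
    unfolding ZG using mat_mult_append[OF zero_carrier_mat one_carrier_mat q, of n] q
    by (simp add: zero_mult_mat_vec)
  finally have Zk: "Z0 *\<^sub>v (G2 *\<^sub>v q) = 0\<^sub>v n @\<^sub>v q" .
  have Z: "Z0 *\<^sub>v \<zeta> = y @\<^sub>v q"
    unfolding \<zeta>_def mult_add_distrib_mat_vec[OF Z0 h k] Zh Zk using y q by (intro eq_vecI) auto
  have GZ: "(G1 @\<^sub>c G2) *\<^sub>v (y @\<^sub>v q) = \<zeta>"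
    unfolding \<zeta>_def by (rule append_cols_mult_vec[OF G1c G2 y q])
  have Gc: "G1 @\<^sub>c G2 \<in> carrier_mat T (n + k)" by (rule append_cols_carrier[OF G1c G2])
  have K: "B * (U0 * (G1 @\<^sub>c G2)) *\<^sub>v (y @\<^sub>v q) = B *\<^sub>v (U0 *\<^sub>v \<zeta>)"
    using B U0 Gc z by (simp add: assoc_mult_mat_vec[of _ n m _ "n + k"] assoc_mult_mat_vec[of _ m T _ "n + k"] GZ)
  have AZ: "A *\<^sub>v (y @\<^sub>v q) = A *\<^sub>v (Z0 *\<^sub>v \<zeta>)" by (simp add: Z)
  have "X1 *\<^sub>v \<zeta> = A *\<^sub>v (Z0 *\<^sub>v \<zeta>) + B *\<^sub>v (U0 *\<^sub>v \<zeta>) + E *\<^sub>v (D0 *\<^sub>v \<zeta>)"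
    unfolding X1 using A B E Z0 U0 D0 \<zeta>
    by (simp add: add_mult_distrib_mat_vec[of _ n T])
  then have "A *\<^sub>v (y @\<^sub>v q) + B * (U0 * (G1 @\<^sub>c G2)) *\<^sub>v (y @\<^sub>v q) = X1 *\<^sub>v \<zeta> - E *\<^sub>v (D0 *\<^sub>v \<zeta>)"
    unfolding AZ K using A B E by (intro eq_vecI) auto
  also have "X1 *\<^sub>v \<zeta> = X1 * G1 *\<^sub>v y + X1 * G2 *\<^sub>v q"
    unfolding \<zeta>_def mult_add_distrib_mat_vec[OF X1c h k] using X1c G1c G2 y q by simp
  also have "E *\<^sub>v (D0 *\<^sub>v \<zeta>) = E *\<^sub>v (D0 *\<^sub>v (G1 *\<^sub>v y)) + E *\<^sub>v (D0 *\<^sub>v (G2 *\<^sub>v q))"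
    unfolding \<zeta>_def using E D0 h k
    by (simp add: mult_add_distrib_mat_vec[OF D0] mult_add_distrib_mat_vec[OF E])
  finally show ?thesis
    using E X1c by (intro eq_vecI) auto
qed

text \<open>Every summand contains one factor \<open>|Q y|\<close> or \<open>b\<close>, of size
  \<open>\<eta> |y|\<close>, and a further factor of order \<open>|y|\<close>. The constant is fixed
  before \<open>\<eta>\<close>, so that \<open>\<eta>\<close> can be shrunk afterwards.\<close>

lemma increment_remainder_small:
  fixes X1 E P1 G1 G2 \<Delta> :: "real mat"
  assumes X1: "X1 \<in> carrier_mat n T" and E: "E \<in> carrier_mat n s" and P: "minv P1 \<in> carrier_mat n n"
    and G1: "G1 \<in> carrier_mat T n" and G2: "G2 \<in> carrier_mat T k"
  obtains C where "0 < C"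
    "\<And>Q y b \<eta>. y \<in> carrier_vec n \<Longrightarrow> Q y \<in> carrier_vec k \<Longrightarrow> 0 \<le> \<eta> \<Longrightarrow> \<eta> \<le> 1 \<Longrightarrow>
      enorm (Q y) \<le> \<eta> * enorm y \<Longrightarrow> 0 \<le> b \<Longrightarrow> b \<le> \<eta> * enorm y \<Longrightarrow>
      ell1 X1 P1 G1 G2 Q y + ell2 X1 E \<Delta> P1 G1 G2 Q y + ell3 X1 E \<Delta> P1 G1 G2 Q y
        + ell4 E \<Delta> P1 G1 G2 Q y + gfun X1 E \<Delta> P1 G1 G2 Q y b \<le> C * \<eta> * (enorm y)\<^sup>2"
proof -
  define L where "L = opnorm2 \<Delta>"
  define M where "M = opnorm2 (transpose_mat E * minv P1 * E)"
  have LM: "0 \<le> L" "0 \<le> M" by (simp_all add: L_def M_def opnorm2_nonneg)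
  have c: "X1 * G1 \<in> carrier_mat n n" "X1 * G2 \<in> carrier_mat n k" "minv P1 * X1 * G2 \<in> carrier_mat n k"
    "transpose_mat (minv P1 * E) \<in> carrier_mat s n" "transpose_mat E * minv P1 * X1 * G2 \<in> carrier_mat s k"
    using X1 E P G1 G2 by auto
  obtain a1 where a1: "0 < a1" "\<And>v. v \<in> carrier_vec n \<Longrightarrow> enorm (X1 * G1 *\<^sub>v v) \<le> a1 * enorm v"
    using mult_mat_vec_bounded[OF c(1)] by blast
  obtain a2 where a2: "0 < a2" "\<And>v. v \<in> carrier_vec k \<Longrightarrow> enorm (X1 * G2 *\<^sub>v v) \<le> a2 * enorm v"
    using mult_mat_vec_bounded[OF c(2)] by blast
  obtain a3 where a3: "0 < a3" "\<And>v. v \<in> carrier_vec k \<Longrightarrow> enorm (minv P1 * X1 * G2 *\<^sub>v v) \<le> a3 * enorm v"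
    using mult_mat_vec_bounded[OF c(3)] by blast
  obtain a4 where a4: "0 < a4"
    "\<And>v. v \<in> carrier_vec n \<Longrightarrow> enorm (transpose_mat (minv P1 * E) *\<^sub>v v) \<le> a4 * enorm v"
    using mult_mat_vec_bounded[OF c(4)] by blast
  obtain a5 where a5: "0 < a5" "\<And>v. v \<in> carrier_vec n \<Longrightarrow> enorm (G1 *\<^sub>v v) \<le> a5 * enorm v"
    using mult_mat_vec_bounded[OF G1] by blast
  obtain a6 where a6: "0 < a6" "\<And>v. v \<in> carrier_vec k \<Longrightarrow> enorm (G2 *\<^sub>v v) \<le> a6 * enorm v"
    using mult_mat_vec_bounded[OF G2] by blast
  obtain a7 where a7: "0 < a7"
    "\<And>v. v \<in> carrier_vec k \<Longrightarrow> enorm (transpose_mat E * minv P1 * X1 * G2 *\<^sub>v v) \<le> a7 * enorm v"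
    using mult_mat_vec_bounded[OF c(5)] by blast
  define U where "U = 2 * a1 + a2"
  define H where "H = 2 * a5 + a6"
  have UH: "0 < U" "0 < H" using a1(1) a2(1) a5(1) a6(1) by (auto simp: U_def H_def)
  note pos = LM UH a1(1) a2(1) a3(1) a4(1) a5(1) a6(1) a7(1)
  \<comment> \<open>The summands are the constants for \<open>ell1\<close> to \<open>ell4\<close>
    and for the terms with \<open>r1\<close>, \<open>r2\<close>, \<open>r3\<close>, in this order;
    the final 1 ensures positivity.\<close>
  define C where "C = U * a3 + L * (a4 * U) * a6 + L * H * a7 + L\<^sup>2 * M * H * a6
      + 2 * (a4 * U) + 2 * L * M * H + M + 1"
  show ?thesis
  proof (rule that)
    show "0 < C" unfolding C_def using pos by (intro add_nonneg_pos add_nonneg_nonneg mult_nonneg_nonneg) auto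
    fix Q :: "real vec \<Rightarrow> real vec" and y b \<eta>
    assume y: "y \<in> carrier_vec n" and q: "Q y \<in> carrier_vec k" and \<eta>: "0 \<le> \<eta>" "\<eta> \<le> 1"
      and Qy: "enorm (Q y) \<le> \<eta> * enorm y" and b: "0 \<le> b" "b \<le> \<eta> * enorm y"
    define N where "N = enorm y"
    have N: "0 \<le> N" by (simp add: N_def)
    have \<eta>N: "0 \<le> \<eta> * N" "\<eta> * N \<le> N" using \<eta> N by (auto simp: mult_left_le_one_le)
    have q\<eta>: "enorm (Q y) \<le> \<eta> * N" using Qy by (simp add: N_def)
    \<comment> \<open>Because \<open>\<eta>\<close> is at most 1, the second factor in terms
      quadratic in \<open>Q y\<close> or \<open>b\<close> can be bounded by \<open>N\<close>, which
      keeps the estimate linear in \<open>\<eta>\<close>.\<close>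
    have qN: "enorm (Q y) \<le> N" using q\<eta> \<eta>N by linarith
    have bN: "b \<le> N" "b \<le> \<eta> * N" using b \<eta>N by (auto simp: N_def)
    have scale: "a * enorm (Q y) \<le> a * (\<eta> * N)" "a * enorm (Q y) \<le> a * N" if "0 < a" for a
      using q\<eta> qN that by (auto intro!: mult_left_mono)
    have cv: "X1 * G1 *\<^sub>v y \<in> carrier_vec n" "X1 * G2 *\<^sub>v Q y \<in> carrier_vec n"
      "G1 *\<^sub>v y \<in> carrier_vec T" "G2 *\<^sub>v Q y \<in> carrier_vec T" "minv P1 * X1 * G2 *\<^sub>v Q y \<in> carrier_vec n"
      using c G1 G2 y q by auto
    have n1: "enorm (X1 * G1 *\<^sub>v y) \<le> a1 * N" using a1(2)[OF y] by (simp add: N_def)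
    have n2: "enorm (X1 * G2 *\<^sub>v Q y) \<le> a2 * N" using a2(2)[OF q] scale(2)[OF a2(1)] by linarith
    have n3: "enorm (minv P1 * X1 * G2 *\<^sub>v Q y) \<le> a3 * (\<eta> * N)" using a3(2)[OF q] scale(1)[OF a3(1)] by linarith
    have n5: "enorm (G1 *\<^sub>v y) \<le> a5 * N" using a5(2)[OF y] by (simp add: N_def)
    have n6: "enorm (G2 *\<^sub>v Q y) \<le> a6 * (\<eta> * N)" "enorm (G2 *\<^sub>v Q y) \<le> a6 * N"
      using a6(2)[OF q] scale[OF a6(1)] by linarith+
    have n7: "enorm (transpose_mat E * minv P1 * X1 * G2 *\<^sub>v Q y) \<le> a7 * (\<eta> * N)"
      using a7(2)[OF q] scale(1)[OF a7(1)] by linarith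
    have aN: "0 \<le> a1 * N" "0 \<le> a5 * N" using a1(1) a5(1) N by simp_all
    have u: "enorm (2 \<cdot>\<^sub>v (X1 * G1 *\<^sub>v y) + X1 * G2 *\<^sub>v Q y) \<le> U * N"
      "enorm (X1 * G1 *\<^sub>v y + X1 * G2 *\<^sub>v Q y) \<le> U * N"
      using enorm_triangle[of "2 \<cdot>\<^sub>v (X1 * G1 *\<^sub>v y)" n "X1 * G2 *\<^sub>v Q y"]
        enorm_triangle[OF cv(1,2)] cv(1,2) n1 n2 aN(1)
      unfolding U_def distrib_right enorm_smult by simp_all
    have v: "enorm (2 \<cdot>\<^sub>v (G1 *\<^sub>v y) + G2 *\<^sub>v Q y) \<le> H * N"
      "enorm (G1 *\<^sub>v y + G2 *\<^sub>v Q y) \<le> H * N"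
      using enorm_triangle[of "2 \<cdot>\<^sub>v (G1 *\<^sub>v y)" T "G2 *\<^sub>v Q y"]
        enorm_triangle[OF cv(3,4)] cv(3,4) n5 n6(2) aN(2)
      unfolding H_def distrib_right enorm_smult by simp_all
    have w: "enorm (transpose_mat (minv P1 * E) *\<^sub>v (2 \<cdot>\<^sub>v (X1 * G1 *\<^sub>v y) + X1 * G2 *\<^sub>v Q y)) \<le> a4 * (U * N)"
      "enorm (transpose_mat (minv P1 * E) *\<^sub>v (X1 * G1 *\<^sub>v y + X1 * G2 *\<^sub>v Q y)) \<le> a4 * (U * N)"
      using order_trans[OF a4(2) mult_left_mono[OF u(1) less_imp_le[OF a4(1)]]]
        order_trans[OF a4(2) mult_left_mono[OF u(2) less_imp_le[OF a4(1)]]] cv by auto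
    have "ell1 X1 P1 G1 G2 Q y \<le> (U * N) * (a3 * (\<eta> * N))"
    proof -
      have "ell1 X1 P1 G1 G2 Q y \<le> enorm (2 \<cdot>\<^sub>v (X1 * G1 *\<^sub>v y) + X1 * G2 *\<^sub>v Q y) * enorm (minv P1 * X1 * G2 *\<^sub>v Q y)"
        unfolding ell1_def using cv by (intro order_trans[OF abs_ge_self scalar_prod_le_enorm[of _ n]]) auto
      also have "\<dots> \<le> (U * N) * (a3 * (\<eta> * N))" using u n3 UH N by (intro mult_mono) auto
      finally show ?thesis .
    qed
    moreover have "ell2 X1 E \<Delta> P1 G1 G2 Q y \<le> L * (a4 * (U * N)) * (a6 * (\<eta> * N))"
      unfolding ell2_def L_def[symmetric] using w n6 pos N by (intro mult_mono mult_left_mono) auto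
    moreover have "ell3 X1 E \<Delta> P1 G1 G2 Q y \<le> L * (H * N) * (a7 * (\<eta> * N))"
      unfolding ell3_def L_def[symmetric] using v n7 pos N by (intro mult_mono mult_left_mono) auto
    moreover have "ell4 E \<Delta> P1 G1 G2 Q y \<le> L\<^sup>2 * M * (H * N) * (a6 * (\<eta> * N))"
      unfolding ell4_def L_def[symmetric] M_def[symmetric]
      using v n6 pos N by (intro mult_mono mult_left_mono) auto
    moreover have "r1 X1 E P1 G1 G2 Q y * b \<le> 2 * (a4 * (U * N)) * (\<eta> * N)"
      unfolding r1_def using w bN b pos N by (intro mult_mono mult_left_mono) auto
    moreover have "r2 E \<Delta> P1 G1 G2 Q y * b \<le> 2 * L * M * (H * N) * (\<eta> * N)"
      unfolding r2_def L_def[symmetric] M_def[symmetric]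
      using v bN b pos N by (intro mult_mono mult_left_mono) auto
    moreover have "r3 E P1 * b\<^sup>2 \<le> M * (N * (\<eta> * N))"
      unfolding r3_def M_def[symmetric] power2_eq_square
      using bN b pos N by (intro mult_mono mult_left_mono) auto
    ultimately have "ell1 X1 P1 G1 G2 Q y + ell2 X1 E \<Delta> P1 G1 G2 Q y + ell3 X1 E \<Delta> P1 G1 G2 Q y
        + ell4 E \<Delta> P1 G1 G2 Q y + gfun X1 E \<Delta> P1 G1 G2 Q y b \<le> (C - 1) * \<eta> * N\<^sup>2"
      unfolding gfun_def C_def by (simp add: power2_eq_square algebra_simps)
    also have "\<dots> \<le> C * \<eta> * N\<^sup>2" using \<eta> by (intro mult_right_mono) auto
    finally show "ell1 X1 P1 G1 G2 Q y + ell2 X1 E \<Delta> P1 G1 G2 Q y + ell3 X1 E \<Delta> P1 G1 G2 Q y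
        + ell4 E \<Delta> P1 G1 G2 Q y + gfun X1 E \<Delta> P1 G1 G2 Q y b \<le> C * \<eta> * (enorm y)\<^sup>2"
      by (simp add: N_def)
  qed
qed

theorem theorem9:
  fixes n m s S T :: nat
    and A B E :: "real mat"
    and Q d :: "real vec \<Rightarrow> real vec"
    and x u :: "nat \<Rightarrow> real vec"
    and QQ :: "real vec set"
    and \<delta> :: real and \<delta>x :: "real vec \<Rightarrow> real"
    and U0 X1 Z0 \<Delta> \<Omega> P1 Y1 G1 G2 K :: "real mat" and \<epsilon> :: real
    and f :: "real vec \<Rightarrow> real vec" and W :: "real vec set"
  assumes dims: "n > 0" "m > 0" "s > 0" "T > 0" "n \<le> S"
    and A: "A \<in> carrier_mat n S" and B: "B \<in> carrier_mat n m" and E: "E \<in> carrier_mat n s"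
    and Q: "Q \<in> carrier_vec n \<rightarrow> carrier_vec (S - n)"
    and Q_nonlinear: "\<And>i. i < S - n \<Longrightarrow> \<not> linear_scalar n (\<lambda>y. Q y $ i)"
    and d: "d \<in> carrier_vec n \<rightarrow> carrier_vec s"
    and d_nonlinear: "\<not> (\<forall>i<s. linear_scalar n (\<lambda>y. d y $ i))"
    and Q_zero: "Q (0\<^sub>v n) = 0\<^sub>v (S - n)" and d_zero: "d (0\<^sub>v n) = 0\<^sub>v s"
    and Q_lim: "((\<lambda>y. enorm (Q y) / enorm y) \<longlongrightarrow> 0) (norm_to_0 n)"
    and QQ: "QQ \<subseteq> carrier_vec n"
    and \<delta>: "\<delta> > 0" "\<And>y. y \<in> QQ \<Longrightarrow> enorm (d y) \<le> \<delta>"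
    and x: "\<And>k. k \<le> T \<Longrightarrow> x k \<in> carrier_vec n"
    and u: "\<And>k. k < T \<Longrightarrow> u k \<in> carrier_vec m"
    and x_data: "\<And>k. k < T \<Longrightarrow>
      x (Suc k) = A *\<^sub>v lift_state Q (x k) + B *\<^sub>v u k + E *\<^sub>v d (x k)"
    and x_in_QQ: "\<And>k. k < T \<Longrightarrow> x k \<in> QQ"
    and U0: "U0 = data_mat m T u"
    and X1: "X1 = data_mat n T (\<lambda>k. x (Suc k))"
    and Z0: "Z0 = data_mat S T (\<lambda>k. lift_state Q (x k))"
    and \<Omega>: "pos_def n \<Omega>"
    and \<Delta>: "\<Delta> = (\<delta> * sqrt (real T)) \<cdot>\<^sub>m 1\<^sub>m s"
    and feasible: "sdp_feasible n S T Z0 X1 E \<Delta> \<Omega> P1 Y1 G2 \<epsilon>"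
    and G1: "G1 = Y1 * minv P1"
    and K: "K = U0 * (G1 @\<^sub>c G2)"
    and \<delta>x: "\<And>y. y \<in> carrier_vec n \<Longrightarrow> \<delta>x y \<ge> 0"
      "\<And>y. y \<in> carrier_vec n \<Longrightarrow> enorm (d y) \<le> \<delta>x y"
    and \<delta>x_lim: "((\<lambda>y. \<delta>x y / enorm y) \<longlongrightarrow> 0) (norm_to_0 n)"
    and f: "f = (\<lambda>y. A *\<^sub>v lift_state Q y + B * K *\<^sub>v lift_state Q y + E *\<^sub>v d y)"
    and W: "W = {y \<in> carrier_vec n.
      ell X1 E \<Delta> \<Omega> P1 G1 G2 Q y + gfun X1 E \<Delta> P1 G1 G2 Q y (\<delta>x y) < 0}"
  shows "asymptotically_stable_equilibrium n f (0\<^sub>v n) \<and>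
    (\<forall>\<gamma>. {y \<in> carrier_vec n. lyap P1 y \<le> \<gamma>} \<subseteq> W \<union> {0\<^sub>v n} \<longrightarrow>
      positively_invariant f {y \<in> carrier_vec n. lyap P1 y \<le> \<gamma>} \<and>
      region_of_attraction n f (0\<^sub>v n) {y \<in> carrier_vec n. lyap P1 y \<le> \<gamma>})"
proof -

  \<comment> \<open>Notation, dimensions and positive definiteness of \<open>P1\<close>\<close>
  define k where "k = S - n"
  have S: "S = n + k" using dims by (simp add: k_def)
  define P where "P = minv P1"
  define L where "L = \<delta> * sqrt (real T)"
  define F where "F = E * \<Delta> * transpose_mat \<Delta> * transpose_mat E"
  define D0 where "D0 = data_mat s T (\<lambda>k. d (x k))"
  have L: "0 \<le> L" using \<delta>(1) by (simp add: L_def)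
  have opL: "opnorm2 \<Delta> = L" unfolding \<Delta> L_def[symmetric] using opnorm2_smult_one[OF dims(3) L] .

  have P1c: "P1 \<in> carrier_mat n n" and P1t: "transpose_mat P1 = P1"
    and Y1: "Y1 \<in> carrier_mat T n" and G2: "G2 \<in> carrier_mat T k" and \<epsilon>: "\<epsilon> > 0"
    and ZY: "Z0 * Y1 = P1 @\<^sub>r 0\<^sub>m k n" and ZG: "Z0 * G2 = 0\<^sub>m n k @\<^sub>r 1\<^sub>m k"
    and lmi: "pos_def (n + n + T)
       (four_block_mat (four_block_mat (P1 - \<Omega>) (transpose_mat (X1 * Y1)) (X1 * Y1) (P1 - \<epsilon> \<cdot>\<^sub>m F))
         (transpose_mat Y1 @\<^sub>r 0\<^sub>m n T) (Y1 @\<^sub>c 0\<^sub>m T n) (\<epsilon> \<cdot>\<^sub>m 1\<^sub>m T))"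
    using feasible by (auto simp: sdp_feasible_def k_def F_def)
  have X1c: "X1 \<in> carrier_mat n T" unfolding X1 by simp
  have Z0c: "Z0 \<in> carrier_mat (n + k) T" unfolding Z0 S by simp
  have U0c: "U0 \<in> carrier_mat m T" unfolding U0 by simp
  have D0c: "D0 \<in> carrier_mat s T" unfolding D0_def by simp
  have \<Delta>c: "\<Delta> \<in> carrier_mat s s" unfolding \<Delta> by simp
  have Et: "transpose_mat E \<in> carrier_mat s n" using E by simp
  have Fc: "F \<in> carrier_mat n n" unfolding F_def using E \<Delta>c by (intro mult_carrier_mat) auto
  have N: "X1 * Y1 \<in> carrier_mat n n" using X1c Y1 by simp
  have R: "P1 - \<epsilon> \<cdot>\<^sub>m F \<in> carrier_mat n n" using Fc by (auto simp: minus_carrier_mat)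
  note \<Omega>c = pos_def_carrier[OF \<Omega>]
  have P1: "pos_def n P1" by (rule lmi_pos_def[OF P1c P1t \<Omega> N R Y1 lmi])
  have Ppd: "pos_def n P" and Pc: "P \<in> carrier_mat n n" and Pt: "transpose_mat P = P"
    unfolding P_def by (rule pos_def_minv[OF P1] minv_carrier[OF P1] minv_transpose[OF P1])+
  have G1P: "G1 = Y1 * P" unfolding G1 P_def ..
  have G1c: "G1 \<in> carrier_mat T n" unfolding G1P using Y1 Pc by simp

  \<comment> \<open>The matrix of disturbance samples and the data equation\<close>
  have xc: "x k \<in> carrier_vec n" if "k < T" for k using x[of k] that by simp
  have dx: "d (x k) \<in> carrier_vec s" if "k < T" for k using d xc[OF that] by auto
  \<comment> \<open>The experiment stays in \<open>QQ\<close>, so the constant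
    \<open>\<delta>\<close> bounds every sample of \<open>d\<close>.\<close>
  have D0t: "enorm (transpose_mat D0 *\<^sub>v w) \<le> L * enorm w" if "w \<in> carrier_vec s" for w
    unfolding D0_def L_def
    using dx x_in_QQ \<delta> that by (intro data_mat_transpose_bound) auto
  have D0b: "enorm (D0 *\<^sub>v v) \<le> L * enorm v" if "v \<in> carrier_vec T" for v
    by (rule enorm_mult_le_of_transpose[OF D0c L D0t that])
  have X1eq: "X1 = A * Z0 + B * U0 + E * D0"
    unfolding X1 Z0 U0 D0_def
  proof (rule data_mat_system[OF A B E])
    fix k assume k: "k < T"
    show "lift_state Q (x k) \<in> carrier_vec S"
      unfolding lift_state_def S using Q xc[OF k] by (auto simp: k_def)
  qed (use u dx x_data in auto)

  \<comment> \<open>As \<open>\<Delta>\<close> is \<open>L\<close> times the identity,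
    \<open>F\<close> is \<open>L^2 E E^T\<close> and its form at \<open>w\<close> is
    \<open>(L |E^T w|)^2\<close>. This is the uncertainty bound required by
    \<open>lmi_decrease\<close> for \<open>D = E D0\<close>.\<close>
  have FL: "(enorm (transpose_mat (E * D0) *\<^sub>v w))\<^sup>2 \<le> w \<bullet> (F *\<^sub>v w)" if w: "w \<in> carrier_vec n" for w
  proof -
    let ?v = "transpose_mat E *\<^sub>v w"
    have v: "?v \<in> carrier_vec s" using Et w by simp
    have \<Delta>v: "\<Delta> *\<^sub>v g = L \<cdot>\<^sub>v g" if "g \<in> carrier_vec s" for g
      unfolding \<Delta> L_def[symmetric] using that by (intro eq_vecI) auto
    have \<Delta>t: "transpose_mat \<Delta> = \<Delta>" unfolding \<Delta> by (intro eq_matI) auto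
    have "F *\<^sub>v w = E *\<^sub>v (\<Delta> *\<^sub>v (\<Delta> *\<^sub>v ?v))"
      unfolding F_def \<Delta>t
      using E \<Delta>c Et w v mult_carrier_mat[OF E \<Delta>c] mult_carrier_mat[OF mult_carrier_mat[OF E \<Delta>c] \<Delta>c]
      by (simp add: assoc_mult_mat_vec[of _ n s _ n] assoc_mult_mat_vec[of _ n s _ s] del: assoc_mult_mat)
    also have "\<dots> = E *\<^sub>v (L\<^sup>2 \<cdot>\<^sub>v ?v)"
      using v by (simp add: \<Delta>v smult_smult_assoc power2_eq_square)
    finally have "w \<bullet> (F *\<^sub>v w) = ?v \<bullet> (L\<^sup>2 \<cdot>\<^sub>v ?v)"
      using transpose_vec_mult_scalar[OF E _ w, of "L\<^sup>2 \<cdot>\<^sub>v ?v"] v by simp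
    then have Fw: "w \<bullet> (F *\<^sub>v w) = (L * enorm ?v)\<^sup>2"
      using v by (simp add: power_mult_distrib enorm_power2)
    have "transpose_mat (E * D0) *\<^sub>v w = transpose_mat D0 *\<^sub>v ?v"
      using transpose_mult[OF E D0c] D0c Et w by simp
    then show ?thesis unfolding Fw using D0t[OF v] by (simp add: power_mono)
  qed

  \<comment> \<open>Decrease along the uncertain linear part\<close>
  obtain c1 where c1: "0 < c1"
    "\<And>D p. D \<in> carrier_mat n T \<Longrightarrow>
      (\<And>w. w \<in> carrier_vec n \<Longrightarrow> (enorm (transpose_mat D *\<^sub>v w))\<^sup>2 \<le> w \<bullet> (F *\<^sub>v w)) \<Longrightarrow>
      p \<in> carrier_vec n \<Longrightarrow>
      (X1 * Y1 *\<^sub>v p - D *\<^sub>v (Y1 *\<^sub>v p)) \<bullet> (P *\<^sub>v (X1 * Y1 *\<^sub>v p - D *\<^sub>v (Y1 *\<^sub>v p)))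
        + p \<bullet> (\<Omega> *\<^sub>v p) + c1 * (enorm p)\<^sup>2 \<le> p \<bullet> (P1 *\<^sub>v p)"
    unfolding P_def using lmi_decrease[OF P1 \<Omega>c N Fc Y1 less_imp_le[OF \<epsilon>] lmi] by blast
  obtain CP where CP: "0 < CP" "\<And>v. v \<in> carrier_vec n \<Longrightarrow> enorm (P1 *\<^sub>v v) \<le> CP * enorm v"
    using mult_mat_vec_bounded[OF P1c] by blast
  \<comment> \<open>The margin \<open>c1\<close> is measured in \<open>p = P y\<close>; since
    \<open>y = P1 p\<close> has norm at most \<open>CP |p|\<close>, dividing by the square of
    \<open>CP\<close> converts it to a margin in \<open>y\<close>.\<close>
  define c where "c = c1 / CP\<^sup>2"
  have c: "0 < c" using c1(1) CP(1) by (simp add: c_def)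

  \<comment> \<open>The closed-loop map and its equilibrium\<close>
  define h where "h y = ell X1 E \<Delta> \<Omega> P1 G1 G2 Q y + gfun X1 E \<Delta> P1 G1 G2 Q y (\<delta>x y)" for y
  have Qc: "Q y \<in> carrier_vec k" and dc: "d y \<in> carrier_vec s" if "y \<in> carrier_vec n" for y
    using Q d that by (auto simp: k_def)
  have f_eq: "f y = (X1 * G1 *\<^sub>v y - E *\<^sub>v (D0 *\<^sub>v (G1 *\<^sub>v y))) +
      (X1 * G2 *\<^sub>v Q y - E *\<^sub>v (D0 *\<^sub>v (G2 *\<^sub>v Q y))) + E *\<^sub>v d y" if y: "y \<in> carrier_vec n" for y
    unfolding f lift_state_def K
    using closed_loop_representation[OF A[unfolded S] B E Z0c U0c D0c X1eq Y1 G2 P1 ZY ZG G1 y Qc[OF y]]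
    by simp
  have fc: "f y \<in> carrier_vec n" if y: "y \<in> carrier_vec n" for y
    unfolding f_eq[OF y] using X1c G1c G2 E D0c y Qc[OF y] dc[OF y] by simp
  \<comment> \<open>The limits are punctured and say nothing about the values at the origin;
    \<open>Q_zero\<close> and \<open>d_zero\<close> make it an equilibrium.\<close>
  have f0: "f (0\<^sub>v n) = 0\<^sub>v n"
    unfolding f_eq[OF zero_carrier_vec] Q_zero d_zero k_def[symmetric]
    using X1c G1c G2 E D0c by (simp add: mult_mat_zero_vec)

  have \<Phi>: "y \<bullet> (P * \<Omega> * P *\<^sub>v y) = (P *\<^sub>v y) \<bullet> (\<Omega> *\<^sub>v (P *\<^sub>v y))"
    if y: "y \<in> carrier_vec n" for y
  proof -
    have p: "P *\<^sub>v y \<in> carrier_vec n" using Pc y by simp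
    have \<Omega>p: "\<Omega> *\<^sub>v (P *\<^sub>v y) \<in> carrier_vec n" using \<Omega>c p by simp
    have "P * \<Omega> * P *\<^sub>v y = P *\<^sub>v (\<Omega> *\<^sub>v (P *\<^sub>v y))"
      using assoc_mult_mat_vec[of "P * \<Omega>" n n P n y] Pc \<Omega>c y p by simp
    then show ?thesis using transpose_vec_mult_scalar[OF Pc \<Omega>p y] Pt by simp
  qed

  \<comment> \<open>Increment of the Lyapunov function\<close>
  have decr: "lyap P1 (f y) \<le> lyap P1 y + h y - c * (enorm y)\<^sup>2" if y: "y \<in> carrier_vec n" for y
  proof -
    let ?a = "X1 * G1 *\<^sub>v y - E *\<^sub>v (D0 *\<^sub>v (G1 *\<^sub>v y))"
    \<comment> \<open>In the variable \<open>p = P y\<close> one has \<open>G1 y = Y1 p\<close> and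
      \<open>p \<bullet> (P1 p) = V(y)\<close>, and by \<open>\<Phi>\<close> the form of
      \<open>\<Omega>\<close> at \<open>p\<close> is the quadratic term of \<open>ell\<close>. So
      the matrix inequality applies at \<open>p\<close>.\<close>
    let ?p = "P *\<^sub>v y"
    have p: "?p \<in> carrier_vec n" using Pc y by simp
    have q: "Q y \<in> carrier_vec k" by (rule Qc[OF y])
    have \<alpha>: "X1 * G1 *\<^sub>v y \<in> carrier_vec n" and \<beta>: "X1 * G2 *\<^sub>v Q y \<in> carrier_vec n"
      and hk: "G1 *\<^sub>v y \<in> carrier_vec T" "G2 *\<^sub>v Q y \<in> carrier_vec T"
      using X1c G1c G2 y q by auto
    have G1y: "G1 *\<^sub>v y = Y1 *\<^sub>v ?p" unfolding G1P using Y1 Pc y by simp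
    have Yp: "Y1 *\<^sub>v ?p \<in> carrier_vec T" using Y1 p by simp
    have a: "?a = X1 * Y1 *\<^sub>v ?p - E * D0 *\<^sub>v (Y1 *\<^sub>v ?p)"
      using X1c Y1 E D0c p Yp G1y G1c y by simp
    have P1p: "P1 *\<^sub>v ?p = y" unfolding P_def by (rule mult_minv_vec(1)[OF P1 y])
    have ED0: "E * D0 \<in> carrier_mat n T" using E D0c by simp
    have "?a \<bullet> (P *\<^sub>v ?a) + ?p \<bullet> (\<Omega> *\<^sub>v ?p) + c1 * (enorm ?p)\<^sup>2 \<le> ?p \<bullet> (P1 *\<^sub>v ?p)"
      unfolding a by (rule c1(2)[OF ED0 FL p])
    moreover have "?p \<bullet> (P1 *\<^sub>v ?p) = lyap P1 y"
      unfolding P1p lyap_def P_def[symmetric] by (rule comm_scalar_prod[OF p y])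
    moreover note \<Phi>[OF y]
    moreover have "c * (enorm y)\<^sup>2 \<le> c1 * (enorm ?p)\<^sup>2"
    proof -
      have "(enorm y)\<^sup>2 \<le> (CP * enorm ?p)\<^sup>2"
        using CP(2)[OF p] unfolding P1p by (rule power_mono) simp
      then show ?thesis using CP(1) c1(1) by (simp add: c_def power_mult_distrib field_simps)
    qed
    moreover have "lyap P1 (f y) \<le> ?a \<bullet> (P *\<^sub>v ?a)
        + ell1 X1 P1 G1 G2 Q y + ell2 X1 E \<Delta> P1 G1 G2 Q y + ell3 X1 E \<Delta> P1 G1 G2 Q y
        + ell4 E \<Delta> P1 G1 G2 Q y + gfun X1 E \<Delta> P1 G1 G2 Q y (\<delta>x y)"
    proof -
      have P\<beta>: "P * X1 * G2 *\<^sub>v Q y = P *\<^sub>v (X1 * G2 *\<^sub>v Q y)"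
        using assoc_mult_mat_vec[of "P * X1" n T G2 k "Q y"] Pc X1c G2 q hk by simp
      have EP\<beta>: "transpose_mat E * P * X1 * G2 *\<^sub>v Q y = transpose_mat E *\<^sub>v (P *\<^sub>v (X1 * G2 *\<^sub>v Q y))"
        unfolding assoc_mult_mat_vec[OF mult_carrier_mat[OF mult_carrier_mat[OF Et Pc] X1c] G2 q]
          assoc_mult_mat_vec[OF mult_carrier_mat[OF Et Pc] X1c hk(2)]
          assoc_mult_mat_vec[OF X1c G2 q]
        using assoc_mult_mat_vec[OF Et Pc] X1c hk(2) by simp
      show ?thesis
        using perturbed_quadratic_form_le[OF Pc Pt E D0c L D0b \<alpha> \<beta> hk dc[OF y] \<delta>x(2)[OF y]]
        unfolding lyap_def f_eq[OF y] ell1_def ell2_def ell3_def ell4_def gfun_def r1_def r2_def r3_def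
          opL P_def[symmetric] P\<beta> EP\<beta>
        by (simp only: add.assoc mult.assoc)
    qed
    ultimately show ?thesis unfolding h_def ell_def P_def[symmetric] by linarith
  qed

  \<comment> \<open>Quadratic bounds on the Lyapunov function\<close>
  obtain a where a: "0 < a" "\<And>v. v \<in> carrier_vec n \<Longrightarrow> a * (enorm v)\<^sup>2 \<le> lyap P1 v"
    unfolding lyap_def using pos_def_coercive[OF Ppd] unfolding P_def by blast
  obtain b where b: "0 < b" "\<And>v. v \<in> carrier_vec n \<Longrightarrow> lyap P1 v \<le> b * (enorm v)\<^sup>2"
  proof -
    obtain b where b: "0 < b" "\<And>v. v \<in> carrier_vec n \<Longrightarrow> enorm (P *\<^sub>v v) \<le> b * enorm v"
      using mult_mat_vec_bounded[OF Pc] by blast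
    have "lyap P1 v \<le> b * (enorm v)\<^sup>2" if v: "v \<in> carrier_vec n" for v
    proof -
      have "lyap P1 v \<le> enorm v * enorm (P *\<^sub>v v)"
        unfolding lyap_def P_def[symmetric]
        using scalar_prod_le_enorm[OF v, of "P *\<^sub>v v"] Pc v by simp
      also have "\<dots> \<le> enorm v * (b * enorm v)" using b(2)[OF v] by (simp add: mult_left_mono)
      finally show ?thesis by (simp add: power2_eq_square algebra_simps)
    qed
    then show thesis using that b(1) by blast
  qed
  have lyap0: "lyap P1 (0\<^sub>v n) = 0" using a(2)[of "0\<^sub>v n"] b(2)[of "0\<^sub>v n"] by simp

  \<comment> \<open>Asymptotic stability of the origin\<close>
  have stable: "asymptotically_stable_equilibrium n f (0\<^sub>v n)"
  proof -
    obtain C where C: "0 < C"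
      "\<And>Q y b \<eta>. y \<in> carrier_vec n \<Longrightarrow> Q y \<in> carrier_vec k \<Longrightarrow> 0 \<le> \<eta> \<Longrightarrow> \<eta> \<le> 1 \<Longrightarrow>
        enorm (Q y) \<le> \<eta> * enorm y \<Longrightarrow> 0 \<le> b \<Longrightarrow> b \<le> \<eta> * enorm y \<Longrightarrow>
        ell1 X1 P1 G1 G2 Q y + ell2 X1 E \<Delta> P1 G1 G2 Q y + ell3 X1 E \<Delta> P1 G1 G2 Q y
          + ell4 E \<Delta> P1 G1 G2 Q y + gfun X1 E \<Delta> P1 G1 G2 Q y b \<le> C * \<eta> * (enorm y)\<^sup>2"
      using increment_remainder_small[OF X1c E minv_carrier[OF P1] G1c G2] by blast
    \<comment> \<open>Half of the margin \<open>c\<close> absorbs the remainder near the origin, and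
      the other half is left as decrease.\<close>
    define \<eta> where "\<eta> = min 1 (c / (2 * C))"
    have \<eta>: "0 < \<eta>" "\<eta> \<le> 1" "C * \<eta> \<le> c / 2" using c C(1) by (auto simp: \<eta>_def min_def field_simps)
    obtain \<rho>1 where \<rho>1: "0 < \<rho>1"
      "\<And>y. y \<in> carrier_vec n \<Longrightarrow> y \<noteq> 0\<^sub>v n \<Longrightarrow> enorm y < \<rho>1 \<Longrightarrow> enorm (Q y) \<le> \<eta> * enorm y"
      using norm_to_0_small[OF Q_lim \<eta>(1)] by blast
    obtain \<rho>2 where \<rho>2: "0 < \<rho>2"
      "\<And>y. y \<in> carrier_vec n \<Longrightarrow> y \<noteq> 0\<^sub>v n \<Longrightarrow> enorm y < \<rho>2 \<Longrightarrow> \<delta>x y \<le> \<eta> * enorm y"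
      using norm_to_0_small[OF \<delta>x_lim \<eta>(1)] by blast
    show ?thesis
    proof (rule lyapunov_asymptotically_stable[where a = a and b = b and V = "lyap P1" and r = "min \<rho>1 \<rho>2" and c = "c / 2"])
      fix y assume y: "y \<in> carrier_vec n" "enorm y < min \<rho>1 \<rho>2"
      show "lyap P1 (f y) \<le> lyap P1 y - c / 2 * (enorm y)\<^sup>2"
      proof (cases "y = 0\<^sub>v n")
        case True
        then show ?thesis using f0 lyap0 by simp
      next
        case False
        have "0 \<le> y \<bullet> (P * \<Omega> * P *\<^sub>v y)"
          using \<Phi>[OF y(1)] pos_def_nonneg[OF \<Omega>, of "P *\<^sub>v y"] Pc y by simp
        then have "h y \<le> C * \<eta> * (enorm y)\<^sup>2"
          using C(2)[of y Q \<eta> "\<delta>x y"] Qc[OF y(1)] \<eta> \<rho>1(2) \<rho>2(2) \<delta>x(1) y False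
          unfolding h_def ell_def P_def[symmetric] by fastforce
        also have "\<dots> \<le> c / 2 * (enorm y)\<^sup>2" using \<eta>(3) by (rule mult_right_mono) simp
        finally show ?thesis using decr[OF y(1)] by simp
      qed
    qed (use a b c \<rho>1 \<rho>2 fc f0 in auto)
  qed

  \<comment> \<open>Sublevel sets: invariance and attraction\<close>
  have "positively_invariant f {y \<in> carrier_vec n. lyap P1 y \<le> \<gamma>} \<and>
      region_of_attraction n f (0\<^sub>v n) {y \<in> carrier_vec n. lyap P1 y \<le> \<gamma>}"
    if sub: "{y \<in> carrier_vec n. lyap P1 y \<le> \<gamma>} \<subseteq> W \<union> {0\<^sub>v n}" for \<gamma>
  proof -
    let ?R = "{y \<in> carrier_vec n. lyap P1 y \<le> \<gamma>}"
    have decrR: "lyap P1 (f y) \<le> lyap P1 y - c * (enorm y)\<^sup>2" if y: "y \<in> ?R" for y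
    proof (cases "y = 0\<^sub>v n")
      case True
      then show ?thesis using f0 lyap0 by simp
    next
      case False
      \<comment> \<open>Away from the origin a point of the sublevel set lies in \<open>W\<close>.
        The sign of \<open>h y\<close> alone gives no rate; the decrease by \<open>c |y|^2\<close>
        comes from the margin in \<open>decr\<close>.\<close>
      then have "h y < 0" using y sub unfolding W h_def by blast
      then show ?thesis using decr[of y] y by simp
    qed
    have fR: "f y \<in> ?R" if y: "y \<in> ?R" for y
    proof -
      have "0 \<le> c * (enorm y)\<^sup>2" using c by simp
      then show ?thesis using decrR[OF y] y fc by auto
    qed
    have "(f ^^ t) x0 \<in> ?R" "tends_to_vec (\<lambda>t. (f ^^ t) x0) (0\<^sub>v n)" if "x0 \<in> ?R" for x0 t
      by (rule lyapunov_decay[OF a(1) b(1) c, of ?R n "lyap P1" f]; use a b decrR fR that in auto)+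
    then show ?thesis
      using stable unfolding positively_invariant_def region_of_attraction_def by blast
  qed
  then show ?thesis using stable by blast
qed

end
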